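(* Let $J\in\mathbb{S}$. For any $q\in D\left(\frac{\pi}{2},\mathcal{C}(J)\right)$ such that $q\ne0$, the injectivity radius of $(\mathbb{B},g)$ at $q$ is finite. On the other hand, the injectivity radius of $(\mathbb{B},g)$ at $q=0$ is infinite.
   Context: $\mathbb{H}$ is the skew-field of quaternions, $\mathbb{B}=\{q\in\mathbb{H}:|q|<1\}$, $\mathbb{S}=\{q\in\mathbb{H}:q^2=-1\}$, $L_I=\mathbb{R}+\mathbb{R}I$ for $I\in\mathbb{S}$. For $J\in\mathbb{S}$, $\mathcal{C}(J)=\mathbb{S}\cap L_J^\perp$ is the great circle of $\mathbb{S}$ orthogonal to $J$, and $D\left(\frac\pi2,\mathcal{C}(J)\right)=\{rI:\ r\in[0,1),\ I\in\mathcal{C}(J)\}$. $g$ is the Riemannian metric on $\mathbb{B}$ given, for $w=x+yI_w\in\mathbb{B}$ and $d=d_1+d_2\in T_w\mathbb{B}\cong\mathbb{H}$ with $d_1\in L_{I_w}$, $d_2\in L_{I_w}^\perp$ (Euclidean orthogonal complement), by $|d|^2_{g(w)}=\frac{|d_1|^2}{(1-|w|^2)^2}+\frac{|d_2|^2}{|1-w^2|^2}$. *)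

theory Defs
  imports "HOL-Analysis.Analysis"
begin

section \<open>Quaternions\<close>

text \<open>
  The quaternion $a + u_1 i + u_2 j + u_3 k$ is the pair of its real part $a$ and its imaginary
  part $u$.  Norm and inner product of the product type are the Euclidean ones of
  four-dimensional space.  In terms of the dot and the cross product of imaginary parts,
  Hamilton's product is $(a, u)(b, v) = (ab - u \cdot v,\; av + bu + u \times v)$.
\<close>

type_synonym quat = "real \<times> (real ^ 3)"

definition quat_one :: quat where
  "quat_one = (1, 0)"

definition quat_mult :: "quat \<Rightarrow> quat \<Rightarrow> quat" where
  "quat_mult p q =
    (fst p * fst q - snd p \<bullet> snd q,
     fst p *\<^sub>R snd q + fst q *\<^sub>R snd p + cross3 (snd p) (snd q))"

lemma quat_mult_assoc: "quat_mult (quat_mult p q) r = quat_mult p (quat_mult q r)"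
  by (simp add: quat_mult_def cross3_simps forall_3)

lemma quat_mult_one [simp]: "quat_mult quat_one q = q" "quat_mult q quat_one = q"
  by (simp_all add: quat_mult_def quat_one_def)

lemma norm_quat_mult: "norm (quat_mult p q) = norm p * norm q"
proof -
  have "quat_mult p q \<bullet> quat_mult p q = (p \<bullet> p) * (q \<bullet> q)"
    unfolding inner_prod_def quat_mult_def by (simp add: cross3_simps)
  then show ?thesis
    by (simp add: norm_eq_sqrt_inner real_sqrt_mult)
qed

definition quat_ball :: "quat set" where
  "quat_ball = {q. norm q < 1}"

definition imag_units :: "quat set" where
  "imag_units = {q. quat_mult q q = - quat_one}"

lemma imag_units_eq: "imag_units = {(0, u) |u. norm u = 1}"
proof -
  have "q \<in> imag_units \<longleftrightarrow> fst q = 0 \<and> norm (snd q) = 1" for q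
  proof -
    have "q \<in> imag_units \<longleftrightarrow> (fst q)\<^sup>2 - (norm (snd q))\<^sup>2 = -1 \<and> (fst q = 0 \<or> snd q = 0)"
      by (auto simp: imag_units_def quat_mult_def quat_one_def prod_eq_iff power2_eq_square
          dot_square_norm simp flip: scaleR_left.add)
    moreover have "(fst q)\<^sup>2 \<noteq> -1"
      by (metis less_eq_real_def neg_0_le_iff_le not_one_le_zero zero_le_power2)
    ultimately show ?thesis
      by (auto simp: abs_square_eq_1)
  qed
  then show ?thesis by (auto simp: prod_eq_iff)
qed

definition slice :: "quat \<Rightarrow> quat set" where
  "slice I = {x *\<^sub>R quat_one + y *\<^sub>R I |x y. True}"

definition great_circle :: "quat \<Rightarrow> quat set" where
  "great_circle J = imag_units \<inter> orthogonal_comp (slice J)"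

text \<open>The set $D(\frac{\pi}{2}, C)$.\<close>

definition disc_half_pi :: "quat set \<Rightarrow> quat set" where
  "disc_half_pi C = {r *\<^sub>R I |r I. 0 \<le> r \<and> r < 1 \<and> I \<in> C}"


section \<open>The metric on the quaternionic unit ball\<close>

text \<open>
  For non-real $w$ the unit $I_w$ is determined up to sign, so its slice is unique.  For real $w$
  every imaginary unit qualifies, but then both denominators of the metric coincide and the metric
  does not depend on the choice.
\<close>

definition unit_of :: "quat \<Rightarrow> quat" where
  "unit_of w = (SOME I. I \<in> imag_units \<and> w \<in> slice I)"

definition slice_part :: "quat \<Rightarrow> quat \<Rightarrow> quat" where
  "slice_part w d =
    (THE d1. d1 \<in> slice (unit_of w) \<and> d - d1 \<in> orthogonal_comp (slice (unit_of w)))"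

definition perp_part :: "quat \<Rightarrow> quat \<Rightarrow> quat" where
  "perp_part w d = d - slice_part w d"

lemma unit_of: "unit_of w \<in> imag_units" "w \<in> slice (unit_of w)"
proof -
  have "\<exists>I. I \<in> imag_units \<and> w \<in> slice I"
  proof (cases "snd w = 0")
    case True
    have "(0, axis 1 1) \<in> imag_units"
      by (simp add: imag_units_eq)
    moreover have "w = fst w *\<^sub>R quat_one + 0 *\<^sub>R (0, axis 1 1)"
      using True by (simp add: quat_one_def prod_eq_iff)
    ultimately show ?thesis unfolding slice_def by blast
  next
    case False
    have "(0, snd w /\<^sub>R norm (snd w)) \<in> imag_units"
      using False by (simp add: imag_units_eq)
    moreover have "w = fst w *\<^sub>R quat_one + norm (snd w) *\<^sub>R (0, snd w /\<^sub>R norm (snd w))"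
      using False by (simp add: quat_one_def prod_eq_iff)
    ultimately show ?thesis unfolding slice_def by blast
  qed
  then have "unit_of w \<in> imag_units \<and> w \<in> slice (unit_of w)"
    unfolding unit_of_def by (rule someI_ex)
  then show "unit_of w \<in> imag_units" "w \<in> slice (unit_of w)" by auto
qed

lemma slice_part_eq:
  "slice_part w d = (d \<bullet> quat_one) *\<^sub>R quat_one + (d \<bullet> unit_of w) *\<^sub>R unit_of w"
proof -
  define I where "I = unit_of w"
  have o: "quat_one \<bullet> quat_one = 1" "quat_one \<bullet> I = 0" "I \<bullet> quat_one = 0" "I \<bullet> I = 1"
    using unit_of(1)[of w] by (auto simp: I_def imag_units_eq quat_one_def dot_square_norm)
  have mem: "x \<in> orthogonal_comp (slice I) \<longleftrightarrow> x \<bullet> quat_one = 0 \<and> x \<bullet> I = 0" for x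
  proof
    assume "x \<in> orthogonal_comp (slice I)"
    then have *: "(a *\<^sub>R quat_one + b *\<^sub>R I) \<bullet> x = 0" for a b
      unfolding orthogonal_comp_def orthogonal_def slice_def by blast
    from *[of 1 0] *[of 0 1] show "x \<bullet> quat_one = 0 \<and> x \<bullet> I = 0"
      by (simp add: inner_commute)
  next
    assume "x \<bullet> quat_one = 0 \<and> x \<bullet> I = 0"
    then show "x \<in> orthogonal_comp (slice I)"
      by (auto simp: orthogonal_comp_def orthogonal_def slice_def inner_add_left inner_add_right
          inner_commute[of _ x])
  qed
  have "(THE d1. d1 \<in> slice I \<and> d - d1 \<in> orthogonal_comp (slice I)) =
      (d \<bullet> quat_one) *\<^sub>R quat_one + (d \<bullet> I) *\<^sub>R I"
  proof (rule the_equality)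
    show "(d \<bullet> quat_one) *\<^sub>R quat_one + (d \<bullet> I) *\<^sub>R I \<in> slice I \<and>
        d - ((d \<bullet> quat_one) *\<^sub>R quat_one + (d \<bullet> I) *\<^sub>R I) \<in> orthogonal_comp (slice I)"
      unfolding mem by (auto simp: slice_def o inner_diff_left inner_add_left)
  next
    fix d1 assume *: "d1 \<in> slice I \<and> d - d1 \<in> orthogonal_comp (slice I)"
    then obtain x y where d1: "d1 = x *\<^sub>R quat_one + y *\<^sub>R I"
      unfolding slice_def by blast
    have "x = d \<bullet> quat_one" "y = d \<bullet> I"
      using * unfolding mem d1 by (simp_all add: o inner_diff_left inner_add_left)
    then show "d1 = (d \<bullet> quat_one) *\<^sub>R quat_one + (d \<bullet> I) *\<^sub>R I"
      using d1 by simp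
  qed
  then show ?thesis by (simp add: slice_part_def I_def)
qed

text \<open>The bilinear form obtained from the quadratic form $|d|^2_{g(w)}$ by polarization.\<close>

definition quat_metric :: "quat \<Rightarrow> quat \<Rightarrow> quat \<Rightarrow> real" where
  "quat_metric w d e =
    (slice_part w d \<bullet> slice_part w e) / (1 - (norm w)\<^sup>2)\<^sup>2 +
    (perp_part w d \<bullet> perp_part w e) / (norm (quat_one - quat_mult w w))\<^sup>2"

lemma quat_metric_diag:
  "quat_metric w d d =
    (norm (slice_part w d))\<^sup>2 / (1 - (norm w)\<^sup>2)\<^sup>2 +
    (norm (perp_part w d))\<^sup>2 / (norm (quat_one - quat_mult w w))\<^sup>2"
  by (simp add: quat_metric_def power2_norm_eq_inner)


section \<open>Riemannian geometry on an open subset of a Euclidean space\<close>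

text \<open>
  In the global chart given by the inclusion of an open set \<open>U\<close>, every tangent space is the ambient
  vector space, and a Riemannian metric is a map \<open>g\<close> sending a point of \<open>U\<close> to an inner product.

  For constant vector fields \<open>u\<close>, \<open>v\<close> the Levi-Civita derivative of \<open>v\<close> along \<open>u\<close> at \<open>x\<close> is the
  vector \<open>z\<close> given by Koszul's formula; on basis vectors its coordinates are the Christoffel
  symbols.
\<close>

definition metric_deriv ::
  "('a::euclidean_space \<Rightarrow> 'a \<Rightarrow> 'a \<Rightarrow> real) \<Rightarrow> 'a \<Rightarrow> 'a \<Rightarrow> 'a \<Rightarrow> 'a \<Rightarrow> real" where
  "metric_deriv g x u v w = frechet_derivative (\<lambda>y. g y v w) (at x) u"

definition christoffel ::
  "('a::euclidean_space \<Rightarrow> 'a \<Rightarrow> 'a \<Rightarrow> real) \<Rightarrow> 'a \<Rightarrow> 'a \<Rightarrow> 'a \<Rightarrow> 'a" where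
  "christoffel g x u v =
    (THE z. \<forall>w. g x z w =
       (metric_deriv g x u v w + metric_deriv g x v u w - metric_deriv g x w u v) / 2)"

text \<open>\<open>c\<close> is a geodesic on the time interval \<open>T\<close> with velocity \<open>c'\<close>.\<close>

definition geodesic_on ::
  "'a::euclidean_space set \<Rightarrow> ('a \<Rightarrow> 'a \<Rightarrow> 'a \<Rightarrow> real) \<Rightarrow> real set \<Rightarrow> (real \<Rightarrow> 'a) \<Rightarrow> (real \<Rightarrow> 'a) \<Rightarrow> bool"
  where
  "geodesic_on U g T c c' \<longleftrightarrow>
    (\<forall>t\<in>T. c t \<in> U \<and>
      (c has_vector_derivative c' t) (at t within T) \<and>
      (c' has_vector_derivative - christoffel g (c t) (c' t) (c' t)) (at t within T))"

text \<open>The geodesic issuing from \<open>p\<close> with velocity \<open>v\<close> exists up to time 1 and is then at \<open>q\<close>.\<close>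

definition geodesic_endpoint ::
  "'a::euclidean_space set \<Rightarrow> ('a \<Rightarrow> 'a \<Rightarrow> 'a \<Rightarrow> real) \<Rightarrow> 'a \<Rightarrow> 'a \<Rightarrow> 'a \<Rightarrow> bool" where
  "geodesic_endpoint U g p v q \<longleftrightarrow>
    (\<exists>c c'. geodesic_on U g {0..1} c c' \<and> c 0 = p \<and> c' 0 = v \<and> c 1 = q)"

definition exp_domain ::
  "'a::euclidean_space set \<Rightarrow> ('a \<Rightarrow> 'a \<Rightarrow> 'a \<Rightarrow> real) \<Rightarrow> 'a \<Rightarrow> 'a set" where
  "exp_domain U g p = {v. \<exists>q. geodesic_endpoint U g p v q}"

definition exp_map ::
  "'a::euclidean_space set \<Rightarrow> ('a \<Rightarrow> 'a \<Rightarrow> 'a \<Rightarrow> real) \<Rightarrow> 'a \<Rightarrow> 'a \<Rightarrow> 'a" where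
  "exp_map U g p v = (THE q. geodesic_endpoint U g p v q)"

text \<open>
  \<open>Ck_on k f S\<close>: on the open set \<open>S\<close>, all iterated directional derivatives of \<open>f\<close> up to order \<open>k\<close>
  exist and are continuous.
\<close>

fun Ck_on :: "nat \<Rightarrow> ('a::euclidean_space \<Rightarrow> 'b::euclidean_space) \<Rightarrow> 'a set \<Rightarrow> bool" where
  "Ck_on 0 f S \<longleftrightarrow> continuous_on S f"
| "Ck_on (Suc k) f S \<longleftrightarrow>
    (\<forall>x\<in>S. f differentiable (at x)) \<and> (\<forall>v. Ck_on k (\<lambda>x. frechet_derivative f (at x) v) S)"

definition smooth_on :: "('a::euclidean_space \<Rightarrow> 'b::euclidean_space) \<Rightarrow> 'a set \<Rightarrow> bool" where
  "smooth_on f S \<longleftrightarrow> (\<forall>k. Ck_on k f S)"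

definition diffeo_onto_image ::
  "('a::euclidean_space \<Rightarrow> 'b::euclidean_space) \<Rightarrow> 'a set \<Rightarrow> bool" where
  "diffeo_onto_image f S \<longleftrightarrow>
    open S \<and> open (f ` S) \<and> inj_on f S \<and> smooth_on f S \<and> smooth_on (inv_into S f) (f ` S)"

definition tangent_ball ::
  "('a::euclidean_space \<Rightarrow> 'a \<Rightarrow> 'a \<Rightarrow> real) \<Rightarrow> 'a \<Rightarrow> real \<Rightarrow> 'a set" where
  "tangent_ball g p a = {v. sqrt (g p v v) < a}"

text \<open>
  The supremum of all radii \<open>a\<close> for which the exponential map at \<open>p\<close> is a diffeomorphism from the
  ball of radius \<open>a\<close> about the origin of the tangent space onto its image; the value may be
  infinite.
\<close>

definition injectivity_radius ::
  "'a::euclidean_space set \<Rightarrow> ('a \<Rightarrow> 'a \<Rightarrow> 'a \<Rightarrow> real) \<Rightarrow> 'a \<Rightarrow> ennreal" where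
  "injectivity_radius U g p =
    Sup {ennreal a |a. 0 < a \<and> tangent_ball g p a \<subseteq> exp_domain U g p \<and>
                       diffeo_onto_image (exp_map U g p) (tangent_ball g p a)}"

end

theory Submission
  imports Defs
begin

text \<open>
  The points of \<open>disc_half_pi (great_circle J)\<close> are purely imaginary.  The purely imaginary points
  form a totally geodesic subset of the ball, on which the metric is invariant under rotations.  In a plane through the origin of this subset, the map
  $u \mapsto Z = 2u/(1-|u|^2)$ turns the metric into $|dZ|^2/(4(1+|Z|^2))$: up to a constant factor
  the plane is Hamilton's cigar, a surface of revolution that is asymptotic to a cylinder.  A
  geodesic that leaves a point \<open>q \<noteq> 0\<close> at a right angle to the meridian of \<open>q\<close> escapes along the
  cylinder while winding around it forever, so that at some time \<open>T\<close> it meets the meridian opposite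
  to \<open>q\<close>.  Its mirror image in the meridian of \<open>q\<close> arrives at the same point at the same time.
  Hence the exponential map at \<open>q\<close> takes the same value at two different vectors, and no ball that
  contains both of them can be mapped injectively (\<open>injectivity_radius_le\<close>).  The winding geodesics
  turn out to be elementary functions (\<open>winding_geodesic\<close>).

  At the origin, every slice is a totally geodesic Poincare disc, so the unit-speed geodesics are
  \<open>t \<mapsto> tanh t *\<^sub>R V\<close> (\<open>radial_geodesic\<close>) and the exponential map is $v \mapsto \tanh(|v|)\, v/|v|$.
  It is a diffeomorphism onto its image on every ball because $\tanh(t)/t$ and $\mathrm{artanh}(t)/t$
  are smooth functions of $t^2$ (\<open>diffeo_radial_tanh\<close>).

  Both arguments exhibit geodesics, while the exponential map is defined by a unique description;
  the two are connected by the uniqueness of geodesics (\<open>geodesic_endpoint_unique\<close>).  It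
  follows from the uniqueness theorem for ordinary differential equations, since the Christoffel
  symbols of the metric are rational functions without poles in the ball (\<open>christoffel_quat_metric\<close>).
\<close>

section \<open>Calculus of smooth maps\<close>

lemma Ck_on_cong:
  fixes f g :: "'a::euclidean_space \<Rightarrow> 'b::euclidean_space"
  assumes "open S" "\<And>x. x \<in> S \<Longrightarrow> f x = g x" "Ck_on k f S"
  shows "Ck_on k g S"
  using assms(2,3)
proof (induction k arbitrary: f g)
  case 0
  then show ?case by (simp cong: continuous_on_cong)
next
  case (Suc k)
  have deriv: "(g has_derivative frechet_derivative f (at x)) (at x)" if "x \<in> S" for x
  proof -
    have "(f has_derivative frechet_derivative f (at x)) (at x)"
      using Suc.prems(2) that by (simp add: frechet_derivative_works)
    then show ?thesis
      using has_derivative_transform_within_open[OF _ \<open>open S\<close> that] Suc.prems(1) by metis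
  qed
  then have "frechet_derivative f (at x) = frechet_derivative g (at x)" if "x \<in> S" for x
    using that by (metis frechet_derivative_at)
  then have "Ck_on k (\<lambda>x. frechet_derivative g (at x) v) S" for v
    using Suc.prems(2)
    by (intro Suc.IH[where f = "\<lambda>x. frechet_derivative f (at x) v"
          and g = "\<lambda>x. frechet_derivative g (at x) v"]) auto
  then show ?case
    using deriv by (auto simp: differentiable_def)
qed

text \<open>
  The derivatives in \<open>Ck_on\<close> are chosen by \<open>frechet_derivative\<close>; this rule accepts an explicit
  derivative \<open>f'\<close> instead.
\<close>

lemma Ck_on_SucI:
  fixes f :: "'a::euclidean_space \<Rightarrow> 'b::euclidean_space"
  assumes "open S" "\<And>x. x \<in> S \<Longrightarrow> (f has_derivative f' x) (at x)"
    and "\<And>v. Ck_on k (\<lambda>x. f' x v) S"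
  shows "Ck_on (Suc k) f S"
proof -
  have "f' x = frechet_derivative f (at x)" if "x \<in> S" for x
    using assms(2)[OF that] by (metis frechet_derivative_at)
  then show ?thesis
    using assms by (auto simp: differentiable_def intro!: Ck_on_cong[OF assms(1) _ assms(3)])
qed

lemma Ck_on_Suc_imp:
  fixes f :: "'a::euclidean_space \<Rightarrow> 'b::euclidean_space"
  shows "Ck_on (Suc k) f S \<Longrightarrow> Ck_on k f S"
proof (induction k arbitrary: f)
  case 0
  then show ?case
    by (simp add: differentiable_at_withinI differentiable_imp_continuous_on differentiable_on_def)
next
  case (Suc k)
  then show ?case by (metis Ck_on.simps(2))
qed

lemma Ck_on_const: "Ck_on k (\<lambda>x::'a::euclidean_space. c::'b::euclidean_space) S"
  by (induction k arbitrary: c) (auto simp: frechet_derivative_const)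

lemma Ck_on_linear:
  fixes f :: "'a::euclidean_space \<Rightarrow> 'b::euclidean_space"
  assumes "bounded_linear f"
  shows "Ck_on k f S"
proof (cases k)
  case 0
  then show ?thesis using assms by (simp add: linear_continuous_on)
next
  case (Suc n)
  have "frechet_derivative f (at x) = f" for x
    using bounded_linear_imp_has_derivative[OF assms] by (metis frechet_derivative_at)
  then show ?thesis
    using Suc Ck_on_const bounded_linear_imp_differentiable[OF assms] by auto
qed

lemma Ck_on_add:
  fixes f g :: "'a::euclidean_space \<Rightarrow> 'b::euclidean_space"
  assumes "open S" "Ck_on k f S" "Ck_on k g S"
  shows "Ck_on k (\<lambda>x. f x + g x) S"
  using assms(2,3)
proof (induction k arbitrary: f g)
  case 0
  then show ?case by (simp add: continuous_on_add)
next
  case (Suc k)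
  show ?case
  proof (rule Ck_on_SucI[OF \<open>open S\<close>])
    fix x assume "x \<in> S"
    then show "((\<lambda>x. f x + g x) has_derivative
        (\<lambda>v. frechet_derivative f (at x) v + frechet_derivative g (at x) v)) (at x)"
      using Suc.prems by (intro has_derivative_add) (auto simp: frechet_derivative_works)
  qed (use Suc in auto)
qed

text \<open>
  By Leibniz' rule, a derivative of \<open>B f g\<close> is a sum of terms of the same form in which one factor is
  differentiated, so one induction covers all products.
\<close>

lemma Ck_on_bilinear:
  fixes f :: "'a::euclidean_space \<Rightarrow> 'b::euclidean_space"
    and g :: "'a \<Rightarrow> 'c::euclidean_space"
    and B :: "'b \<Rightarrow> 'c \<Rightarrow> 'd::euclidean_space"
  assumes B: "bounded_bilinear B" and "open S" "Ck_on k f S" "Ck_on k g S"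
  shows "Ck_on k (\<lambda>x. B (f x) (g x)) S"
  using assms(3,4)
proof (induction k arbitrary: f g)
  case 0
  then show ?case by (simp add: bounded_bilinear.continuous_on[OF B])
next
  case (Suc k)
  show ?case
  proof (rule Ck_on_SucI[OF \<open>open S\<close>])
    fix x assume "x \<in> S"
    then show "((\<lambda>x. B (f x) (g x)) has_derivative
        (\<lambda>v. B (f x) (frechet_derivative g (at x) v) + B (frechet_derivative f (at x) v) (g x))) (at x)"
      using Suc.prems by (intro bounded_bilinear.FDERIV[OF B]) (auto simp: frechet_derivative_works)
  next
    fix v
    show "Ck_on k (\<lambda>x. B (f x) (frechet_derivative g (at x) v) +
        B (frechet_derivative f (at x) v) (g x)) S"
      using Suc.prems \<open>open S\<close> Ck_on_Suc_imp[OF Suc.prems(1)] Ck_on_Suc_imp[OF Suc.prems(2)]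
      by (intro Ck_on_add Suc.IH) simp_all
  qed
qed

text \<open>
  An outer function of one real variable keeps the chain rule within products of real functions:
  a derivative of \<open>h \<circ> f\<close> is a derivative of \<open>f\<close> times \<open>h' \<circ> f\<close>, to which the induction applies.
\<close>

lemma Ck_on_compose_real:
  fixes f :: "'a::euclidean_space \<Rightarrow> real" and h :: "real \<Rightarrow> real"
  assumes "open S" "open T" "Ck_on k f S" "Ck_on k h T" "f ` S \<subseteq> T"
  shows "Ck_on k (\<lambda>x. h (f x)) S"
  using assms(3,4)
proof (induction k arbitrary: h)
  case 0
  then show ?case using assms(5) by (auto intro: continuous_on_compose2)
next
  case (Suc k)
  show ?case
  proof (rule Ck_on_SucI[OF \<open>open S\<close>])
    fix x assume x: "x \<in> S"
    have f: "(f has_derivative frechet_derivative f (at x)) (at x)"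
      using Suc.prems x by (auto simp: frechet_derivative_works)
    have h: "(h has_derivative frechet_derivative h (at (f x))) (at (f x))"
      using Suc.prems x assms(5) by (auto simp: frechet_derivative_works)
    have "v * frechet_derivative h (at (f x)) 1 = frechet_derivative h (at (f x)) v" for v
      using linear_cmul[OF has_derivative_linear[OF h], of v 1] by (simp only: real_scaleR_def mult_1_right)
    then have "(h has_derivative (*) (frechet_derivative h (at (f x)) 1)) (at (f x))"
      using has_derivative_imp_has_field_derivative[OF h] by (metis has_field_derivative_def)
    from diff_chain_at[OF f this] show "((\<lambda>x. h (f x)) has_derivative
        (\<lambda>v. frechet_derivative h (at (f x)) 1 * frechet_derivative f (at x) v)) (at x)"
      by (simp add: o_def)
  next
    fix v
    show "Ck_on k (\<lambda>x. frechet_derivative h (at (f x)) 1 * frechet_derivative f (at x) v) S"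
      using Suc.prems \<open>open S\<close> Ck_on_Suc_imp[OF Suc.prems(1)]
      by (intro Ck_on_bilinear[OF bounded_bilinear_mult] Suc.IH[of "\<lambda>y. frechet_derivative h (at y) 1"])
        simp_all
  qed
qed

text \<open>
  The derivative \<open>- inverse x * inverse x\<close> is again a product of reciprocals.
\<close>

lemma Ck_on_inverse_real: "Ck_on k (inverse :: real \<Rightarrow> real) (- {0})"
proof (induction k)
  case 0
  then show ?case by (auto intro: continuous_intros)
next
  case (Suc k)
  show ?case
  proof (rule Ck_on_SucI)
    fix x :: real assume "x \<in> - {0}"
    then show "(inverse has_derivative (\<lambda>v. - v * (inverse x * inverse x))) (at x)"
      by (auto intro!: derivative_eq_intros simp: power2_eq_square)
  next
    fix v :: real
    show "Ck_on k (\<lambda>x. - v * (inverse x * inverse x)) (- {0})"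
      using Suc by (intro Ck_on_bilinear[OF bounded_bilinear_mult] Ck_on_const) auto
  qed auto
qed

lemma smooth_on_const: "smooth_on (\<lambda>x. c) S"
  by (simp add: smooth_on_def Ck_on_const)

lemma smooth_on_linear: "bounded_linear f \<Longrightarrow> smooth_on f S"
  by (simp add: smooth_on_def Ck_on_linear)

lemma smooth_on_cong:
  "open S \<Longrightarrow> smooth_on f S \<Longrightarrow> (\<And>x. x \<in> S \<Longrightarrow> f x = g x) \<Longrightarrow> smooth_on g S"
  unfolding smooth_on_def by (blast intro: Ck_on_cong)

lemma smooth_on_add:
  "open S \<Longrightarrow> smooth_on f S \<Longrightarrow> smooth_on g S \<Longrightarrow> smooth_on (\<lambda>x. f x + g x) S"
  by (simp add: smooth_on_def Ck_on_add)

lemma smooth_on_scaleR: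
  "open S \<Longrightarrow> smooth_on f S \<Longrightarrow> smooth_on g S \<Longrightarrow> smooth_on (\<lambda>x. f x *\<^sub>R g x) S"
  by (simp add: smooth_on_def Ck_on_bilinear[OF bounded_bilinear_scaleR])

lemma smooth_on_mult:
  fixes f g :: "'a::euclidean_space \<Rightarrow> real"
  shows "open S \<Longrightarrow> smooth_on f S \<Longrightarrow> smooth_on g S \<Longrightarrow> smooth_on (\<lambda>x. f x * g x) S"
  by (simp add: smooth_on_def Ck_on_bilinear[OF bounded_bilinear_mult])

lemma smooth_on_inner:
  "open S \<Longrightarrow> smooth_on f S \<Longrightarrow> smooth_on g S \<Longrightarrow> smooth_on (\<lambda>x. f x \<bullet> g x) S"
  by (simp add: smooth_on_def Ck_on_bilinear[OF bounded_bilinear_inner])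

lemma smooth_on_linear_compose:
  fixes f :: "'a::euclidean_space \<Rightarrow> 'b::euclidean_space"
    and L :: "'b \<Rightarrow> 'c::euclidean_space"
  assumes "bounded_linear L" "open S" "smooth_on f S"
  shows "smooth_on (\<lambda>x. L (f x)) S"
proof -
  have "bounded_bilinear (\<lambda>(r::real) x. r *\<^sub>R L x)"
    by (rule bounded_bilinear.comp[OF bounded_bilinear_scaleR bounded_linear_ident assms(1)])
  from Ck_on_bilinear[OF this assms(2) Ck_on_const[where c=1]] show ?thesis
    using assms(3) by (auto simp: smooth_on_def)
qed

lemma smooth_on_Pair:
  assumes "open S" "smooth_on f S" "smooth_on g S"
  shows "smooth_on (\<lambda>x. (f x, g x)) S"
proof -
  have "smooth_on (\<lambda>x. (f x, 0) + (0, g x)) S"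
    using assms by (intro smooth_on_add smooth_on_linear_compose[where L = "\<lambda>y. (y, 0)"]
        smooth_on_linear_compose[where L = "\<lambda>y. (0, y)"])
      (auto intro!: bounded_linear_Pair bounded_linear_zero bounded_linear_ident)
  then show ?thesis by simp
qed

lemma smooth_on_diff:
  assumes "open S" "smooth_on f S" "smooth_on g S"
  shows "smooth_on (\<lambda>x. f x - g x) S"
proof -
  have "smooth_on (\<lambda>x. f x + (-1) *\<^sub>R g x) S"
    using assms by (intro smooth_on_add smooth_on_scaleR smooth_on_const)
  then show ?thesis by simp
qed

lemma smooth_on_power:
  fixes f :: "'a::euclidean_space \<Rightarrow> real"
  shows "open S \<Longrightarrow> smooth_on f S \<Longrightarrow> smooth_on (\<lambda>x. f x ^ n) S"
  by (induction n) (simp_all add: smooth_on_const smooth_on_mult)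

lemma smooth_on_compose_real:
  fixes f :: "'a::euclidean_space \<Rightarrow> real" and h :: "real \<Rightarrow> real"
  shows "open S \<Longrightarrow> open T \<Longrightarrow> smooth_on f S \<Longrightarrow> smooth_on h T \<Longrightarrow> f ` S \<subseteq> T \<Longrightarrow>
    smooth_on (\<lambda>x. h (f x)) S"
  unfolding smooth_on_def by (blast intro: Ck_on_compose_real)

lemma smooth_on_divide:
  fixes f g :: "'a::euclidean_space \<Rightarrow> real"
  assumes "open S" "smooth_on f S" "smooth_on g S" "\<And>x. x \<in> S \<Longrightarrow> g x \<noteq> 0"
  shows "smooth_on (\<lambda>x. f x / g x) S"
proof -
  have "smooth_on (inverse :: real \<Rightarrow> real) (- {0})"
    by (simp add: smooth_on_def Ck_on_inverse_real)
  then have "smooth_on (\<lambda>x. inverse (g x)) S"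
    using assms by (intro smooth_on_compose_real[OF assms(1) _ assms(3), where T = "- {0}"]) auto
  then have "smooth_on (\<lambda>x. f x * inverse (g x)) S"
    using assms by (intro smooth_on_mult)
  then show ?thesis by (simp add: divide_inverse)
qed

section \<open>The metric and its Christoffel symbols in coordinates\<close>

text \<open>
  For a quaternion \<open>w\<close> with imaginary part \<open>u\<close>, the two denominators of the metric are the squares of
  $1-|w|^2$ and of $|1-w^2|$.  The second square is the sum of $(1-|w|^2)^2$ and $4|u|^2$, and in this
  form both are polynomials in the coordinates.
\<close>

definition defect :: "quat \<Rightarrow> real" where
  "defect w = 1 - (fst w)\<^sup>2 - snd w \<bullet> snd w"

definition square_defect :: "quat \<Rightarrow> real" where
  "square_defect w = (defect w)\<^sup>2 + 4 * (snd w \<bullet> snd w)"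

lemma defect_eq: "defect w = 1 - (norm w)\<^sup>2"
  by (cases w) (simp add: defect_def norm_Pair power2_norm_eq_inner)

lemma defect_pos_iff: "0 < defect w \<longleftrightarrow> w \<in> quat_ball"
  by (simp add: defect_eq quat_ball_def abs_square_less_1)

lemma square_defect_pos: "w \<in> quat_ball \<Longrightarrow> 0 < square_defect w"
  unfolding square_defect_def using defect_pos_iff[of w]
  by (intro add_pos_nonneg) auto

lemma defects_nonzero:
  assumes "w \<in> quat_ball"
  shows "defect w \<noteq> 0" "square_defect w \<noteq> 0"
  using assms square_defect_pos[of w] by (auto simp flip: defect_pos_iff)

lemma square_defect_eq: "square_defect w = (norm (quat_one - quat_mult w w))\<^sup>2"
proof -
  obtain x u where w: "w = (x, u)" by (cases w)
  define U where "U = u \<bullet> u"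
  have "quat_one - quat_mult w w = (1 - x\<^sup>2 + U, (- 2 * x) *\<^sub>R u)"
    by (simp add: w quat_one_def quat_mult_def cross_refl U_def power2_eq_square flip: scaleR_left.add)
  then have "(norm (quat_one - quat_mult w w))\<^sup>2 = (1 - x\<^sup>2 + U)\<^sup>2 + (- 2 * x)\<^sup>2 * U"
    by (simp only: power2_norm_eq_inner U_def inner_Pair inner_scaleR_left inner_scaleR_right
        inner_real_def) (simp add: power2_eq_square)
  also have "\<dots> = square_defect w"
    unfolding w square_defect_def defect_def by (simp add: U_def[symmetric] power2_eq_square algebra_simps)
  finally show ?thesis ..
qed

lemma quat_ball_eq_ball: "quat_ball = ball 0 1"
  by (auto simp: quat_ball_def)

lemma open_quat_ball: "open quat_ball"
  by (simp add: quat_ball_eq_ball)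

lemma convex_quat_ball: "convex quat_ball"
  by (simp add: quat_ball_eq_ball)

text \<open>
  The unit \<open>I\<close> of \<open>w\<close> is a discontinuous function of \<open>w\<close> near the real axis.  It enters the metric
  only through $(v \cdot I)(z \cdot I)\,\bigl(1/P^2 - 1/Q\bigr)$ with \<open>P = defect w\<close> and
  \<open>Q = square_defect w\<close>.  As $1/P^2 - 1/Q = 4|u|^2/(P^2Q)$, the factor $|u|^2$ turns \<open>I\<close> into \<open>u\<close>, so
  the metric is a rational function on the whole ball.
\<close>

lemma quat_metric_formula:
  assumes "w \<in> quat_ball"
  shows "quat_metric w d e = fst d * fst e / (defect w)\<^sup>2 + snd d \<bullet> snd e / square_defect w
    + 4 * (snd d \<bullet> snd w) * (snd e \<bullet> snd w) / ((defect w)\<^sup>2 * square_defect w)"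
proof -
  obtain i where I: "unit_of w = (0, i)" and i: "i \<bullet> i = 1"
    using unit_of(1)[of w] by (auto simp: imag_units_eq dot_square_norm)
  obtain y where u: "snd w = y *\<^sub>R i"
    using that unit_of(2)[of w] unfolding slice_def I quat_one_def by force
  obtain a v b z where de: "d = (a, v)" "e = (b, z)" by (cases d, cases e)
  define P where "P = defect w"
  define Q where "Q = square_defect w"
  have PQ: "P \<noteq> 0" "Q \<noteq> 0" "Q = P\<^sup>2 + 4 * y\<^sup>2"
    using defects_nonzero[OF assms] by (simp_all add: P_def Q_def square_defect_def u i power2_eq_square)
  have par: "slice_part w d \<bullet> slice_part w e = a * b + (v \<bullet> i) * (z \<bullet> i)"
    by (simp add: slice_part_eq I de quat_one_def i)
  have perp: "perp_part w d \<bullet> perp_part w e = v \<bullet> z - (v \<bullet> i) * (z \<bullet> i)"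
    by (simp add: perp_part_def slice_part_eq I de quat_one_def i inner_diff_left inner_diff_right
        inner_commute)
  have "quat_metric w d e = (a * b + (v \<bullet> i) * (z \<bullet> i)) / P\<^sup>2 + (v \<bullet> z - (v \<bullet> i) * (z \<bullet> i)) / Q"
    by (simp add: quat_metric_def par perp P_def Q_def defect_eq square_defect_eq)
  also have "\<dots> = a * b / P\<^sup>2 + v \<bullet> z / Q + (v \<bullet> i) * (z \<bullet> i) * (1 / P\<^sup>2 - 1 / Q)"
    by (simp add: diff_divide_distrib add_divide_distrib right_diff_distrib)
  also have "1 / P\<^sup>2 - 1 / Q = 4 * y\<^sup>2 / (P\<^sup>2 * Q)"
    using PQ by (simp add: field_simps)
  finally show ?thesis
    by (simp add: de u P_def Q_def power2_eq_square mult_ac)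
qed

text \<open>
  The derivative of \<open>quat_metric w d e\<close> with respect to \<open>w\<close> in the direction \<open>h\<close>; \<open>dP\<close> and \<open>dQ\<close> are
  the derivatives of the two defects.
\<close>

definition metric_variation :: "quat \<Rightarrow> quat \<Rightarrow> quat \<Rightarrow> quat \<Rightarrow> real" where
  "metric_variation w h d e =
    (let P = defect w; Q = square_defect w;
         dP = - 2 * (fst w * fst h + snd w \<bullet> snd h);
         dQ = 2 * P * dP + 8 * (snd w \<bullet> snd h)
     in - 2 * dP / P ^ 3 * (fst d * fst e) - dQ / Q\<^sup>2 * (snd d \<bullet> snd e)
        - 4 * (2 * dP * Q + dQ * P) / (P ^ 3 * Q\<^sup>2) * (snd d \<bullet> snd w) * (snd e \<bullet> snd w)
        + 4 / (P\<^sup>2 * Q) * ((snd d \<bullet> snd h) * (snd e \<bullet> snd w) + (snd d \<bullet> snd w) * (snd e \<bullet> snd h)))"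

lemma has_derivative_quat_metric:
  assumes "w \<in> quat_ball"
  shows "((\<lambda>y. quat_metric y d e) has_derivative (\<lambda>h. metric_variation w h d e)) (at w)"
proof -
  define dP where "dP h = - 2 * (fst w * fst h + snd w \<bullet> snd h)" for h :: quat
  define dQ where "dQ h = 2 * defect w * dP h + 8 * (snd w \<bullet> snd h)" for h :: quat
  note pos = defects_nonzero[OF assms]
  have [derivative_intros]: "(defect has_derivative dP) (at w)"
    unfolding defect_def[abs_def] dP_def[abs_def]
    by (auto intro!: derivative_eq_intros simp: inner_commute algebra_simps)
  have [derivative_intros]: "(square_defect has_derivative dQ) (at w)"
    unfolding square_defect_def[abs_def] dQ_def[abs_def]
    by (auto intro!: derivative_eq_intros simp: inner_commute algebra_simps)
  have "((\<lambda>y. fst d * fst e / (defect y)\<^sup>2 + snd d \<bullet> snd e / square_defect y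
    + 4 * (snd d \<bullet> snd y) * (snd e \<bullet> snd y) / ((defect y)\<^sup>2 * square_defect y))
    has_derivative (\<lambda>h. metric_variation w h d e)) (at w)"
    unfolding metric_variation_def Let_def dP_def[symmetric] dQ_def[symmetric]
    by (rule derivative_eq_intros refl | simp add: pos)+
       (simp add: fun_eq_iff pos power2_eq_square power3_eq_cube divide_simps,
        simp add: algebra_simps)
  then show ?thesis
    by (rule has_derivative_transform_within_open[OF _ open_quat_ball assms])
      (simp add: quat_metric_formula)
qed

lemma metric_deriv_quat_metric:
  "w \<in> quat_ball \<Longrightarrow> metric_deriv quat_metric w h d e = metric_variation w h d e"
  unfolding metric_deriv_def
  using has_derivative_quat_metric[of w d e] by (metis frechet_derivative_at)

text \<open>
  Positive definiteness: the metric is a sum of three nonnegative terms, of which the first two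
  already control the real and the imaginary part.
\<close>

lemma quat_metric_nondegenerate:
  assumes w: "w \<in> quat_ball" and eq: "\<And>e. quat_metric w d e = quat_metric w d' e"
  shows "d = d'"
proof -
  have pos: "defect w > 0" "square_defect w > 0"
    using w square_defect_pos defect_pos_iff[of w] by auto
  obtain a v where av: "d - d' = (a, v)" by (cases "d - d'")
  have "quat_metric w (d - d') e = quat_metric w d e - quat_metric w d' e" for e
    by (simp add: quat_metric_formula[OF w] inner_diff_left diff_divide_distrib algebra_simps)
  then have "quat_metric w (a, v) (a, v) = 0"
    by (simp add: eq flip: av)
  then have "a\<^sup>2 / (defect w)\<^sup>2 + v \<bullet> v / square_defect w
      + 4 * (v \<bullet> snd w)\<^sup>2 / ((defect w)\<^sup>2 * square_defect w) = 0"
    by (simp add: quat_metric_formula[OF w] power2_eq_square mult.assoc)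
  moreover have "0 \<le> a\<^sup>2 / (defect w)\<^sup>2" "0 \<le> v \<bullet> v / square_defect w"
      "0 \<le> 4 * (v \<bullet> snd w)\<^sup>2 / ((defect w)\<^sup>2 * square_defect w)"
    using pos by auto
  ultimately have "a\<^sup>2 / (defect w)\<^sup>2 = 0" "v \<bullet> v / square_defect w = 0" by linarith+
  then have "a = 0" "v = 0" using pos by auto
  then show ?thesis using av by (simp flip: zero_prod_def)
qed

text \<open>
  The vector \<open>\<Gamma>(d, d)\<close> at \<open>w\<close>, as it occurs in the geodesic equation.  It is obtained by
  solving Koszul's formula for the metric in rational form: with \<open>P\<close> and \<open>Q\<close> as below, the inverse of
  the metric multiplies the real part by $P^2$ and maps an imaginary part \<open>z\<close> to $Qz - 4(u \cdot z)u$.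
  The term $|u|^2|v|^2 - (u \cdot v)^2$ in the real part vanishes for \<open>d\<close> in the slice of \<open>w\<close>, where
  only the Christoffel symbols of the Poincare disc remain.
\<close>

definition christoffel_diag :: "quat \<Rightarrow> quat \<Rightarrow> quat" where
  "christoffel_diag w d =
    (let x = fst w; u = snd w; a = fst d; v = snd d; P = defect w; Q = square_defect w
     in ((2 * x * a\<^sup>2 + 4 * a * (u \<bullet> v) - 2 * x * (v \<bullet> v)) / P
           + 8 * x * ((u \<bullet> u) * (v \<bullet> v) - (u \<bullet> v)\<^sup>2) * (Q + P\<^sup>2) / (P * Q\<^sup>2),
         ((4 * P * (x * a + u \<bullet> v) - 8 * (u \<bullet> v)) / Q) *\<^sub>R v
         + (16 * (x * a + u \<bullet> v) * (u \<bullet> v) / (P * Q) + 4 * (v \<bullet> v) / Q - 2 * a\<^sup>2 / P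
            + P\<^sup>2 * (4 - 2 * P) * (v \<bullet> v) / Q\<^sup>2
            - 8 * (Q - 2 * P + P\<^sup>2) * (u \<bullet> v)\<^sup>2 / (P * Q\<^sup>2)) *\<^sub>R u))"

text \<open>
  Koszul's formula.  Both sides are linear in \<open>e\<close> and rational in \<open>P\<close>, \<open>Q\<close>, the real parts and the
  inner products of \<open>u\<close>, \<open>v\<close> and the imaginary part of \<open>e\<close>; replacing \<open>u \<bullet> u\<close> by $(Q - P^2)/4$ leaves a polynomial
  identity after clearing denominators.
\<close>

lemma quat_metric_christoffel_diag:
  assumes "w \<in> quat_ball"
  shows "quat_metric w (christoffel_diag w d) e =
    (metric_deriv quat_metric w d d e + metric_deriv quat_metric w d d e
      - metric_deriv quat_metric w e d d) / 2"
proof -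
  obtain x u where w: "w = (x, u)" by (cases w)
  obtain a v where d: "d = (a, v)" by (cases d)
  obtain b z where e: "e = (b, z)" by (cases e)
  define P where "P = defect w"
  define Q where "Q = square_defect w"
  define U V B S T where "U = u \<bullet> u" and "V = v \<bullet> v" and "B = u \<bullet> v" and "S = u \<bullet> z" and "T = v \<bullet> z"
  have pos: "P \<noteq> 0" "Q \<noteq> 0"
    using defects_nonzero[OF assms] by (simp_all add: P_def Q_def)
  have U: "U = (Q - P\<^sup>2) / 4"
    by (simp add: Q_def P_def square_defect_def U_def w)
  have dots: "v \<bullet> u = B" "z \<bullet> u = S" "u \<bullet> z = S" "u \<bullet> v = B" "u \<bullet> u = U" "v \<bullet> v = V" "v \<bullet> z = T" "z \<bullet> v = T"
    by (simp_all add: inner_commute B_def S_def T_def U_def V_def)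
  show ?thesis
    unfolding metric_deriv_quat_metric[OF assms] quat_metric_formula[OF assms] metric_variation_def Let_def
      christoffel_diag_def P_def[symmetric] Q_def[symmetric]
    unfolding w d e fst_conv snd_conv inner_add_left inner_scaleR_left dots U
    using pos
    by (simp add: power2_eq_square power3_eq_cube divide_simps) (simp add: algebra_simps)
qed

lemma christoffel_quat_metric:
  assumes "w \<in> quat_ball"
  shows "christoffel quat_metric w d d = christoffel_diag w d"
  unfolding christoffel_def
  by (rule the_equality)
    (auto simp: quat_metric_christoffel_diag[OF assms] intro!: quat_metric_nondegenerate[OF assms])

section \<open>Uniqueness of geodesics\<close>

text \<open>
  Continuity bounds the directional derivatives along the basis vectors on \<open>K\<close>, hence the operator
  norm of the derivative, and the mean value inequality applies on the convex set \<open>K\<close>.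
\<close>

lemma C1_imp_lipschitz_on_compact:
  fixes F :: "'a::euclidean_space \<Rightarrow> 'b::euclidean_space"
  assumes F: "Ck_on 1 F W" and K: "compact K" "convex K" "K \<subseteq> W"
  obtains L where "\<And>x y. x \<in> K \<Longrightarrow> y \<in> K \<Longrightarrow> norm (F x - F y) \<le> L * norm (x - y)"
proof -
  let ?F' = "\<lambda>x. frechet_derivative F (at x)"
  have deriv: "(F has_derivative ?F' x) (at x)" if "x \<in> W" for x
    using F that by (simp add: frechet_derivative_works)
  have "\<exists>M. \<forall>x\<in>K. norm (?F' x b) \<le> M" for b
  proof -
    have "continuous_on K (\<lambda>x. ?F' x b)"
      using F K(3) by (auto intro: continuous_on_subset)
    then have "bounded ((\<lambda>x. ?F' x b) ` K)"
      using K(1) compact_continuous_image compact_imp_bounded by blast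
    then show ?thesis by (auto simp: bounded_iff)
  qed
  then obtain M where M: "\<And>b x. x \<in> K \<Longrightarrow> norm (?F' x b) \<le> M b"
    by metis
  have "onorm (?F' x) \<le> (\<Sum>b\<in>Basis. M b)" if x: "x \<in> K" for x
  proof (rule onorm_le)
    fix h
    have lin: "linear (?F' x)"
      using deriv x K(3) has_derivative_linear by blast
    have "norm (?F' x h) = norm (\<Sum>b\<in>Basis. (h \<bullet> b) *\<^sub>R ?F' x b)"
      by (subst euclidean_representation[of h, symmetric])
        (simp only: linear_sum[OF lin] linear_cmul[OF lin] o_def)
    also have "\<dots> \<le> (\<Sum>b\<in>Basis. norm h * M b)"
    proof (rule sum_norm_le)
      fix b :: 'a assume "b \<in> Basis"
      then show "norm ((h \<bullet> b) *\<^sub>R ?F' x b) \<le> norm h * M b"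
        using M[OF x, of b] Basis_le_norm[of b h] by (auto intro!: mult_mono)
    qed
    finally show "norm (?F' x h) \<le> (\<Sum>b\<in>Basis. M b) * norm h"
      by (simp add: sum_distrib_left mult.commute)
  qed
  then have "norm (F x - F y) \<le> (\<Sum>b\<in>Basis. M b) * norm (x - y)" if "x \<in> K" "y \<in> K" for x y
    using deriv K that by (intro differentiable_bound[OF K(2), where f' = ?F'])
      (auto intro: has_derivative_at_withinI)
  then show thesis using that by blast
qed

text \<open>
  Gronwall's argument: with a Lipschitz constant \<open>L\<close> of \<open>F\<close> on a compact convex set containing both
  trajectories, the function $e^{-2Lt}\,|y(t)-z(t)|^2$ is nonincreasing, nonnegative and zero at the
  start.
\<close>

lemma autonomous_ode_unique:
  fixes F :: "'a::euclidean_space \<Rightarrow> 'a"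
  assumes F: "Ck_on 1 F W" and W: "convex W"
    and y: "\<And>t. t \<in> {0..T} \<Longrightarrow> y t \<in> W \<and> (y has_vector_derivative F (y t)) (at t within {0..T})"
    and z: "\<And>t. t \<in> {0..T} \<Longrightarrow> z t \<in> W \<and> (z has_vector_derivative F (z t)) (at t within {0..T})"
    and init: "y 0 = z 0" and t: "t \<in> {0..T}"
  shows "y t = z t"
proof -
  have cont: "continuous_on {0..T} y" "continuous_on {0..T} z"
    unfolding continuous_on_eq_continuous_within
    using y z has_vector_derivative_continuous by blast+
  \<comment> \<open>The convex hull stays in \<open>W\<close> as \<open>W\<close> is convex, so one Lipschitz constant serves all times.\<close>
  define K where "K = convex hull (y ` {0..T} \<union> z ` {0..T})"
  have "compact K"
    unfolding K_def using cont
    by (intro compact_convex_hull compact_Un compact_continuous_image) auto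
  moreover have "convex K" by (simp add: K_def convex_convex_hull)
  moreover have "K \<subseteq> W"
    unfolding K_def using y z by (intro hull_minimal W) auto
  ultimately obtain L where L: "norm (F p - F q) \<le> L * norm (p - q)" if "p \<in> K" "q \<in> K" for p q
    using C1_imp_lipschitz_on_compact[OF F] by metis
  have inK: "y s \<in> K" "z s \<in> K" if "s \<in> {0..T}" for s
    using that by (auto simp: K_def intro: hull_inc)
  define \<delta> where "\<delta> s = y s - z s" for s
  define \<phi> where "\<phi> s = exp (- (2 * L) * s) * (\<delta> s \<bullet> \<delta> s)" for s
  define \<phi>' where "\<phi>' s = exp (- (2 * L) * s) * (2 * (\<delta> s \<bullet> (F (y s) - F (z s))) - 2 * L * (\<delta> s \<bullet> \<delta> s))" for s
  have \<delta>': "(\<delta> has_vector_derivative (F (y s) - F (z s))) (at s within {0..T})" if "s \<in> {0..T}" for s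
    unfolding \<delta>_def[abs_def] using y[OF that] z[OF that] by (intro has_vector_derivative_diff) auto
  have \<phi>': "(\<phi> has_derivative (\<lambda>h. \<phi>' s * h)) (at s within {0..T})" if "s \<in> {0..T}" for s
    unfolding \<phi>_def[abs_def] using \<delta>'[OF that, unfolded has_vector_derivative_def]
    by (auto intro!: derivative_eq_intros simp: \<phi>'_def inner_commute algebra_simps)
  have neg: "\<phi>' s \<le> 0" if "s \<in> {0..T}" for s
  proof -
    have "\<delta> s \<bullet> (F (y s) - F (z s)) \<le> norm (\<delta> s) * norm (F (y s) - F (z s))"
      by (rule norm_cauchy_schwarz)
    also have "\<dots> \<le> norm (\<delta> s) * (L * norm (\<delta> s))"
      using L[OF inK[OF that]] by (intro mult_left_mono) (auto simp: \<delta>_def)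
    also have "\<dots> = L * (\<delta> s \<bullet> \<delta> s)"
      by (simp add: dot_square_norm power2_eq_square)
    finally show ?thesis
      unfolding \<phi>'_def by (intro mult_nonneg_nonpos) auto
  qed
  have "\<phi> t \<le> \<phi> 0"
  proof (cases "t = 0")
    case False
    then have "0 < t" using t by auto
    have sub: "{0..t} \<subseteq> {0..T}" using t by auto
    have "(\<phi> has_derivative (\<lambda>h. \<phi>' s * h)) (at s within {0..t})" if "0 \<le> s" "s \<le> t" for s
      using \<phi>'[of s] that t by (intro has_derivative_subset[OF _ sub]) auto
    from mvt_simple[OF \<open>0 < t\<close> this]
    obtain s where "s \<in> {0<..<t}" "\<phi> t - \<phi> 0 = \<phi>' s * (t - 0)"
      by blast
    moreover have "\<phi>' s * (t - 0) \<le> 0"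
      using neg[of s] \<open>s \<in> {0<..<t}\<close> t by (intro mult_nonpos_nonneg) auto
    ultimately show ?thesis by simp
  qed simp
  moreover have "\<phi> 0 = 0" by (simp add: \<phi>_def \<delta>_def init)
  ultimately have "\<delta> t \<bullet> \<delta> t \<le> 0"
    by (simp add: \<phi>_def mult_le_0_iff)
  then have "\<delta> t = 0"
    by (metis inner_eq_zero_iff inner_ge_zero order_antisym)
  then show ?thesis by (simp add: \<delta>_def)
qed

text \<open>
  For the pair of position and velocity the geodesic equation is an autonomous first-order system on
  the convex set \<open>U \<times> UNIV\<close>, so \<open>autonomous_ode_unique\<close> applies.
\<close>

lemma geodesic_endpoint_unique:
  fixes \<Gamma> :: "'a::euclidean_space \<Rightarrow> 'a \<Rightarrow> 'a"
  assumes U: "open U" "convex U" and \<Gamma>: "smooth_on (\<lambda>(w, d). \<Gamma> w d) (U \<times> UNIV)"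
    and eq: "\<And>w d. w \<in> U \<Longrightarrow> christoffel g w d d = \<Gamma> w d"
    and "geodesic_endpoint U g p v q" "geodesic_endpoint U g p v q'"
  shows "q = q'"
proof -
  let ?F = "\<lambda>(w, d). (d, - \<Gamma> w d)"
  have "smooth_on (\<lambda>y. (snd y, 0 - (case y of (w, d) \<Rightarrow> \<Gamma> w d))) (U \<times> UNIV)"
    using U by (intro smooth_on_Pair smooth_on_diff \<Gamma> smooth_on_const
        smooth_on_linear[OF bounded_linear_snd]) (auto intro: open_Times)
  then have F: "Ck_on 1 ?F (U \<times> UNIV)"
    unfolding smooth_on_def by (simp only: case_prod_unfold diff_0)
  obtain c c' where c: "geodesic_on U g {0..1} c c'" "c 0 = p" "c' 0 = v" "c 1 = q"
    using assms unfolding geodesic_endpoint_def by blast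
  obtain e e' where e: "geodesic_on U g {0..1} e e'" "e 0 = p" "e' 0 = v" "e 1 = q'"
    using assms unfolding geodesic_endpoint_def by blast
  have phase: "(c t, c' t) \<in> U \<times> UNIV \<and>
      ((\<lambda>t. (c t, c' t)) has_vector_derivative ?F (c t, c' t)) (at t within {0..1})"
    if "geodesic_on U g {0..1} c c'" "t \<in> {0..1}" for c c' t
  proof -
    have "c t \<in> U" "(c has_vector_derivative c' t) (at t within {0..1})"
      "(c' has_vector_derivative - \<Gamma> (c t) (c' t)) (at t within {0..1})"
      using that eq unfolding geodesic_on_def by metis+
    then show ?thesis by (auto intro!: has_vector_derivative_Pair)
  qed
  have "(c 1, c' 1) = (e 1, e' 1)"
    using autonomous_ode_unique[OF F convex_Times[OF U(2) convex_UNIV] phase[OF c(1)] phase[OF e(1)], of 1]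
    by (simp add: c e)
  then show ?thesis by (simp add: c e)
qed

lemma smooth_on_christoffel_diag: "smooth_on (\<lambda>(w, d). christoffel_diag w d) (quat_ball \<times> UNIV)"
proof -
  let ?S = "quat_ball \<times> (UNIV :: quat set)"
  have S: "open ?S" by (simp add: open_Times open_quat_ball)
  have lin: "smooth_on (\<lambda>z. fst (fst z)) ?S" "smooth_on (\<lambda>z. snd (fst z)) ?S"
    "smooth_on (\<lambda>z. fst (snd z)) ?S" "smooth_on (\<lambda>z. snd (snd z)) ?S"
    by (intro smooth_on_linear bounded_linear_intros)+
  have P: "smooth_on (\<lambda>z. defect (fst z)) ?S"
    unfolding defect_def[abs_def]
    by (intro smooth_on_diff smooth_on_const smooth_on_power smooth_on_inner lin S)
  have Q: "smooth_on (\<lambda>z. square_defect (fst z)) ?S"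
    unfolding square_defect_def[abs_def]
    by (intro smooth_on_add smooth_on_mult smooth_on_const smooth_on_power smooth_on_inner lin S P)
  show ?thesis
    unfolding christoffel_diag_def Let_def case_prod_unfold
    by (intro smooth_on_Pair smooth_on_add smooth_on_diff smooth_on_mult smooth_on_scaleR smooth_on_divide smooth_on_const
       smooth_on_power smooth_on_inner lin S P Q) (auto simp: defects_nonzero)
qed

lemma quat_exp_map_eq:
  assumes "geodesic_endpoint quat_ball quat_metric p v q"
  shows "exp_map quat_ball quat_metric p v = q" "v \<in> exp_domain quat_ball quat_metric p"
proof -
  note uniq = geodesic_endpoint_unique[OF open_quat_ball convex_quat_ball
      smooth_on_christoffel_diag christoffel_quat_metric]
  show "exp_map quat_ball quat_metric p v = q"
    unfolding exp_map_def using assms by (rule the_equality) (rule uniq[OF _ _ assms])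
  show "v \<in> exp_domain quat_ball quat_metric p"
    using assms unfolding exp_domain_def by blast
qed

lemma christoffel_diag_scale:
  "christoffel_diag w (r *\<^sub>R d) = r\<^sup>2 *\<^sub>R christoffel_diag w d"
  unfolding christoffel_diag_def Let_def
  by (simp add: power2_eq_square divide_inverse algebra_simps)

text \<open>
  A complete geodesic \<open>c\<close>, run at \<open>T\<close> times its speed, solves the geodesic equation on \<open>{0..1}\<close>
  because the Christoffel symbols are quadratic in the velocity.
\<close>

lemma geodesic_endpointI:
  assumes "\<And>t. c t \<in> quat_ball" "\<And>t. (c has_vector_derivative c' t) (at t)"
    and "\<And>t. (c' has_vector_derivative - christoffel_diag (c t) (c' t)) (at t)"
  shows "geodesic_endpoint quat_ball quat_metric (c 0) (T *\<^sub>R c' 0) (c T)"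
  unfolding geodesic_endpoint_def
proof (intro exI conjI)
  have scale: "((\<lambda>t. T * t) has_real_derivative T) (at t within {0..1})" for t
    by (auto intro!: derivative_eq_intros)
  show "geodesic_on quat_ball quat_metric {0..1} (\<lambda>t. c (T * t)) (\<lambda>t. T *\<^sub>R c' (T * t))"
    unfolding geodesic_on_def
  proof (intro ballI conjI)
    fix t :: real
    show "((\<lambda>t. c (T * t)) has_vector_derivative T *\<^sub>R c' (T * t)) (at t within {0..1})"
      using vector_diff_chain_within[OF _ has_vector_derivative_at_within[OF assms(2)], of "\<lambda>t. T * t" T t]
        scale by (simp add: o_def has_real_derivative_iff_has_vector_derivative)
    have "((\<lambda>t. c' (T * t)) has_vector_derivative T *\<^sub>R - christoffel_diag (c (T * t)) (c' (T * t))) (at t within {0..1})"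
      using vector_diff_chain_within[OF _ has_vector_derivative_at_within[OF assms(3)], of "\<lambda>t. T * t" T t]
        scale by (simp add: o_def has_real_derivative_iff_has_vector_derivative)
    from bounded_linear.has_vector_derivative[OF bounded_linear_scaleR_right this, of T]
    show "((\<lambda>t. T *\<^sub>R c' (T * t)) has_vector_derivative
        - christoffel quat_metric (c (T * t)) (T *\<^sub>R c' (T * t)) (T *\<^sub>R c' (T * t))) (at t within {0..1})"
      by (simp add: christoffel_quat_metric[OF assms(1)] christoffel_diag_scale power2_eq_square)
  qed (rule assms(1))
qed auto

section \<open>Two explicit families of geodesics\<close>

text \<open>
  Along a line through the origin the Christoffel symbols are those of the Poincare disc of the
  slice: with \<open>d = (1 - f\<^sup>2) *\<^sub>R V\<close> the value is $2 f\,|d|^2/(1-f^2)$ in the direction of \<open>V\<close>.  This is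
  what the second derivative of \<open>tanh\<close> cancels.
\<close>

lemma christoffel_diag_radial:
  assumes V: "norm V = 1" and f: "f\<^sup>2 < 1"
  shows "christoffel_diag (f *\<^sub>R V) ((1 - f\<^sup>2) *\<^sub>R V) = (2 * f * (1 - f\<^sup>2)) *\<^sub>R V"
proof -
  obtain X Y where XY: "V = (X, Y)" by (cases V)
  define y where "y = Y \<bullet> Y"
  define P where "P = 1 - f\<^sup>2"
  define Q where "Q = P\<^sup>2 + 4 * f\<^sup>2 * y"
  have "X\<^sup>2 + y = 1"
    using V by (simp add: XY norm_Pair y_def power2_norm_eq_inner)
  then have X: "X\<^sup>2 = 1 - y" by simp
  have y: "0 \<le> y" by (simp add: y_def)
  have P: "P > 0" using f by (simp add: P_def)
  then have Q: "Q > 0" unfolding Q_def using y by (intro add_pos_nonneg) auto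
  have defect: "defect (f *\<^sub>R V) = P"
    using V by (simp add: defect_eq P_def power_mult_distrib)
  then have sq: "square_defect (f *\<^sub>R V) = Q"
    by (simp add: square_defect_def Q_def XY y_def power2_eq_square)
  have f2: "f\<^sup>2 = 1 - P" by (simp add: P_def)
  have 1: "(2 * (f * X) * (P * X)\<^sup>2 + 4 * (P * X) * (f * P * y) - 2 * (f * X) * (P\<^sup>2 * y)) / P
      + 8 * (f * X) * ((f\<^sup>2 * y) * (P\<^sup>2 * y) - (f * P * y)\<^sup>2) * (Q + P\<^sup>2) / (P * Q\<^sup>2)
      = 2 * f * P * X"
    using P Q X by (simp add: power_mult_distrib field_simps) algebra
  have 2: "(4 * P * (f * X * (P * X) + f * P * y) - 8 * (f * P * y)) / Q * P
      + (16 * (f * X * (P * X) + f * P * y) * (f * P * y) / (P * Q) + 4 * (P\<^sup>2 * y) / Q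
        - 2 * (P * X)\<^sup>2 / P + P\<^sup>2 * (4 - 2 * P) * (P\<^sup>2 * y) / Q\<^sup>2
        - 8 * (Q - 2 * P + P\<^sup>2) * (f * P * y)\<^sup>2 / (P * Q\<^sup>2)) * f = 2 * f * P"
  proof -
    have s: "f * X * (P * X) + f * P * y = f * P"
      using X by algebra
    have "(4 * P * (f * P) - 8 * (f * P * y)) / Q * P
      + (16 * (f * P) * (f * P * y) / (P * Q) + 4 * (P\<^sup>2 * y) / Q
        - 2 * (P\<^sup>2 * (1 - y)) / P + P\<^sup>2 * (4 - 2 * P) * (P\<^sup>2 * y) / Q\<^sup>2
        - 8 * (Q - 2 * P + P\<^sup>2) * (f * P * y)\<^sup>2 / (P * Q\<^sup>2)) * f = 2 * f * P"
      using P Q f2 Q_def by (simp add: divide_simps) algebra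
    then show ?thesis unfolding s power_mult_distrib[of P X] X .
  qed
  have dots: "(f *\<^sub>R Y) \<bullet> (P *\<^sub>R Y) = f * P * y" "(f *\<^sub>R Y) \<bullet> (f *\<^sub>R Y) = f\<^sup>2 * y"
      "(P *\<^sub>R Y) \<bullet> (P *\<^sub>R Y) = P\<^sup>2 * y"
    by (simp_all add: y_def power2_eq_square)
  show ?thesis
    unfolding christoffel_diag_def Let_def defect sq P_def[symmetric]
    unfolding XY scaleR_Pair fst_conv snd_conv dots real_scaleR_def scaleR_scaleR
      scaleR_left_distrib[symmetric] 1 2 ..
qed

lemma radial_geodesic:
  assumes V: "norm V = 1"
  shows "geodesic_endpoint quat_ball quat_metric 0 (T *\<^sub>R V) (tanh T *\<^sub>R V)"
proof -
  have tanh: "(tanh t)\<^sup>2 < 1" for t :: real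
    using tanh_real_bounds[of t] by (simp add: abs_square_less_1 abs_less_iff)
  have "geodesic_endpoint quat_ball quat_metric (tanh 0 *\<^sub>R V) (T *\<^sub>R ((1 - (tanh 0)\<^sup>2) *\<^sub>R V)) (tanh T *\<^sub>R V)"
  proof (rule geodesic_endpointI)
    fix t :: real
    show "tanh t *\<^sub>R V \<in> quat_ball"
      using tanh_real_bounds[of t] V by (simp add: quat_ball_def abs_less_iff)
    have "(tanh has_real_derivative 1 - (tanh t)\<^sup>2) (at t)"
      by (auto intro!: derivative_eq_intros)
    from has_vector_derivative_scaleR[OF this has_vector_derivative_const]
    show "((\<lambda>t. tanh t *\<^sub>R V) has_vector_derivative (1 - (tanh t)\<^sup>2) *\<^sub>R V) (at t)"
      by simp
    have "((\<lambda>t. 1 - (tanh t)\<^sup>2) has_real_derivative - (2 * tanh t * (1 - (tanh t)\<^sup>2))) (at t)"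
      by (auto intro!: derivative_eq_intros)
    from has_vector_derivative_scaleR[OF this has_vector_derivative_const]
    have "((\<lambda>t. (1 - (tanh t)\<^sup>2) *\<^sub>R V) has_vector_derivative - ((2 * tanh t * (1 - (tanh t)\<^sup>2)) *\<^sub>R V)) (at t)"
      by simp
    then show "((\<lambda>t. (1 - (tanh t)\<^sup>2) *\<^sub>R V) has_vector_derivative
        - christoffel_diag (tanh t *\<^sub>R V) ((1 - (tanh t)\<^sup>2) *\<^sub>R V)) (at t)"
      by (simp add: christoffel_diag_radial[OF V tanh])
  qed
  then show ?thesis by simp
qed

text \<open>
  The parameter \<open>B\<close> is $(1+|u|^2)/(1-|u|^2)$, which is $\sqrt{1+|Z|^2}$ in the conformal coordinate
  $Z = 2u/(1-|u|^2)$ of the cigar.  The assumptions are the values of the inner products along the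
  winding geodesics below, where \<open>\<beta>\<close> is the derivative of \<open>B\<close> and \<open>b\<close> is the initial value of \<open>B\<close>.
\<close>

lemma christoffel_diag_imaginary:
  assumes B: "B > 0" and U: "u \<bullet> u = (B - 1) / (B + 1)" and b: "u \<bullet> v = \<beta> / (1 + B)\<^sup>2"
    and n: "v \<bullet> v = (b\<^sup>2 * B\<^sup>2 - \<beta>\<^sup>2) / (1 + B)\<^sup>2" and bs: "\<beta>\<^sup>2 = B\<^sup>2 - b\<^sup>2"
  shows "- christoffel_diag (0, u) (0, v) =
    (0, (2 * \<beta> / (B * (1 + B))) *\<^sub>R v - ((b\<^sup>2 * (B\<^sup>2 + B + 1) - \<beta>\<^sup>2) / (B * (1 + B))) *\<^sub>R u)"
proof -
  have P: "defect (0, u) = 2 / (1 + B)"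
    using B by (simp add: defect_def U field_simps)
  have Q: "square_defect (0, u) = 4 * B\<^sup>2 / (1 + B)\<^sup>2"
    using B by (simp add: square_defect_def P U power2_eq_square divide_simps) (simp add: algebra_simps)
  have nz: "B \<noteq> 0" "1 + B \<noteq> 0" "B + 1 \<noteq> 0" using B by auto
  have 1: "(4 * (2 / (1 + B)) * (\<beta> / (1 + B)\<^sup>2) - 8 * (\<beta> / (1 + B)\<^sup>2)) / (4 * B\<^sup>2 / (1 + B)\<^sup>2)
     = - (2 * \<beta> / (B * (1 + B)))"
    using nz by (simp add: power2_eq_square divide_simps) (simp add: algebra_simps)
  have 2: "16 * (\<beta> / (1 + B)\<^sup>2) * (\<beta> / (1 + B)\<^sup>2) / (2 / (1 + B) * (4 * B\<^sup>2 / (1 + B)\<^sup>2)) +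
      4 * ((b\<^sup>2 * B\<^sup>2 - \<beta>\<^sup>2) / (1 + B)\<^sup>2) / (4 * B\<^sup>2 / (1 + B)\<^sup>2) +
      (2 / (1 + B))\<^sup>2 * (4 - 2 * (2 / (1 + B))) * ((b\<^sup>2 * B\<^sup>2 - \<beta>\<^sup>2) / (1 + B)\<^sup>2) / (4 * B\<^sup>2 / (1 + B)\<^sup>2)\<^sup>2 -
      8 * (4 * B\<^sup>2 / (1 + B)\<^sup>2 - 2 * (2 / (1 + B)) + (2 / (1 + B))\<^sup>2) * (\<beta> / (1 + B)\<^sup>2)\<^sup>2 /
        (2 / (1 + B) * (4 * B\<^sup>2 / (1 + B)\<^sup>2)\<^sup>2)
    = (b\<^sup>2 * (B\<^sup>2 + B + 1) - \<beta>\<^sup>2) / (B * (1 + B))"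
    using nz bs by (simp add: divide_simps) algebra
  show ?thesis
    unfolding christoffel_diag_def Let_def P Q fst_conv snd_conv b n
    using 1 2 by simp
qed


text \<open>
  In terms of the conformal coordinate \<open>Z\<close> of the cigar, Clairaut's relation can be integrated in
  closed form for a geodesic that starts at \<open>Z = a\<close> at a right angle to the meridian.  With the plane
  of \<open>I\<close> and \<open>e\<close> regarded as the complex plane, it is
  $Z(t) = e^{iat}(a \cosh t + i \sinh t)$.  As $|Z|^2 + 1 = b^2 \cosh^2 t$ is a square, the point
  $u = Z/(1 + \sqrt{1+|Z|^2})$ is $Z/(1 + b \cosh t)$.

  The verification uses the rotating frame \<open>e1\<close>, \<open>e2\<close> (that is, $e^{iat}$ and $ie^{iat}$), in which
  position, velocity and acceleration have coefficients without trigonometric functions.  All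
  remaining identities are consequences of $\cosh^2 t = 1 + \sinh^2 t$ and $b^2 = 1 + a^2$.
\<close>

lemma winding_geodesic:
  fixes I e :: "real ^ 3"
  assumes orth: "I \<bullet> I = 1" "e \<bullet> e = 1" "I \<bullet> e = 0" and b: "b > 0" and ab: "b\<^sup>2 = 1 + a\<^sup>2"
  shows "geodesic_endpoint quat_ball quat_metric
    (0, (a / (1 + b)) *\<^sub>R I) (T *\<^sub>R (0, (b\<^sup>2 / (1 + b)) *\<^sub>R e))
    (0, (1 / (1 + b * cosh T)) *\<^sub>R
      ((a * cosh T * cos (a * T) - sinh T * sin (a * T)) *\<^sub>R I
       + (a * cosh T * sin (a * T) + sinh T * cos (a * T)) *\<^sub>R e))"
proof -
  define B where "B t = b * cosh t" for t :: real
  define p where "p t = a * cosh t / (1 + B t)" for t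
  define q where "q t = sinh t / (1 + B t)" for t
  define m where "m t = - a * B t * sinh t / (1 + B t)\<^sup>2" for t
  define n where "n t = b * (B t + (B t)\<^sup>2 - (sinh t)\<^sup>2) / (1 + B t)\<^sup>2" for t
  define e1 where "e1 t = cos (a * t) *\<^sub>R I + sin (a * t) *\<^sub>R e" for t
  define e2 where "e2 t = - sin (a * t) *\<^sub>R I + cos (a * t) *\<^sub>R e" for t
  define u where "u t = p t *\<^sub>R e1 t + q t *\<^sub>R e2 t" for t
  define v where "v t = m t *\<^sub>R e1 t + n t *\<^sub>R e2 t" for t
  have Bpos: "B t > 0" for t using b by (simp add: B_def)
  have nz: "B t \<noteq> 0" "1 + B t \<noteq> 0" for t using Bpos[of t] by auto
  have CS: "(cosh t)\<^sup>2 = 1 + (sinh t)\<^sup>2" for t :: real by (simp add: cosh_square_eq)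
  have B': "(B has_real_derivative b * sinh t) (at t)" for t
    unfolding B_def[abs_def] by (auto intro!: derivative_eq_intros)
  have e1': "(e1 has_vector_derivative a *\<^sub>R e2 t) (at t)" for t
    unfolding e1_def[abs_def] e2_def
    by (auto intro!: derivative_eq_intros simp: algebra_simps)
  have e2': "(e2 has_vector_derivative (- a) *\<^sub>R e1 t) (at t)" for t
    unfolding e2_def[abs_def] e1_def
    by (auto intro!: derivative_eq_intros simp: algebra_simps)
  have frame': "((\<lambda>t. f t *\<^sub>R e1 t + g t *\<^sub>R e2 t) has_vector_derivative
      (f' - a * g t) *\<^sub>R e1 t + (g' + a * f t) *\<^sub>R e2 t) (at t)"
    if "(f has_real_derivative f') (at t)" "(g has_real_derivative g') (at t)" for f g f' g' t
    using has_vector_derivative_add[OF has_vector_derivative_scaleR[OF that(1) e1']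
        has_vector_derivative_scaleR[OF that(2) e2']]
    by (simp add: algebra_simps)
  have frame: "e1 t \<bullet> e1 t = 1" "e2 t \<bullet> e2 t = 1" "e1 t \<bullet> e2 t = 0" "e2 t \<bullet> e1 t = 0" for t
    using orth sin_cos_squared_add[of "a * t"]
    by (simp_all add: e1_def e2_def inner_add_left inner_add_right inner_diff_left inner_diff_right
        inner_commute power2_eq_square add.commute)
  have dot: "(k *\<^sub>R e1 t + l *\<^sub>R e2 t) \<bullet> (k' *\<^sub>R e1 t + l' *\<^sub>R e2 t) = k * k' + l * l'" for k l k' l' t
    by (simp add: inner_add_left inner_add_right frame)
  have uu: "u t \<bullet> u t = (B t - 1) / (B t + 1)" for t
  proof -
    have "p t * p t + q t * q t = (B t - 1) / (B t + 1)"
      using nz[of t] CS[of t] ab B_def[of t] unfolding p_def q_def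
      by (simp add: divide_simps) algebra
    then show ?thesis by (simp add: u_def dot)
  qed
  have uv: "u t \<bullet> v t = (b * sinh t) / (1 + B t)\<^sup>2" for t
  proof -
    have "p t * m t + q t * n t = (b * sinh t) / (1 + B t)\<^sup>2"
      using nz[of t] CS[of t] ab B_def[of t] unfolding p_def q_def m_def n_def
      by (simp add: divide_simps) algebra
    then show ?thesis by (simp add: u_def v_def dot)
  qed
  have vv: "v t \<bullet> v t = (b\<^sup>2 * (B t)\<^sup>2 - (b * sinh t)\<^sup>2) / (1 + B t)\<^sup>2" for t
  proof -
    have "m t * m t + n t * n t = (b\<^sup>2 * (B t)\<^sup>2 - (b * sinh t)\<^sup>2) / (1 + B t)\<^sup>2"
      using nz[of t] CS[of t] ab B_def[of t] unfolding m_def n_def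
      by (simp add: divide_simps) algebra
    then show ?thesis by (simp add: v_def dot)
  qed
  have bS: "(b * sinh t)\<^sup>2 = (B t)\<^sup>2 - b\<^sup>2" for t
    using CS[of t] by (simp add: B_def power_mult_distrib algebra_simps)
  \<comment> \<open>The derivatives of the coefficients \<open>m\<close> and \<open>n\<close> of the velocity.\<close>
  define m' where "m' t = - a * ((B t * cosh t + b * (sinh t)\<^sup>2) * (1 + B t) - 2 * b * B t * (sinh t)\<^sup>2) / (1 + B t) ^ 3" for t
  define n' where "n' t = b * sinh t * ((b + 2 * b * B t - 2 * cosh t) * (1 + B t) - 2 * b * (B t + (B t)\<^sup>2 - (sinh t)\<^sup>2)) / (1 + B t) ^ 3" for t
  have p': "(p has_real_derivative m t + a * q t) (at t)" for t
  proof -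
    have "(p has_real_derivative (a * sinh t * (1 + B t) - a * cosh t * (b * sinh t)) / ((1 + B t) * (1 + B t))) (at t)"
      unfolding p_def[abs_def] using nz[of t]
      by (auto intro!: derivative_eq_intros B')
    moreover have "(a * sinh t * (1 + B t) - a * cosh t * (b * sinh t)) / ((1 + B t) * (1 + B t)) = m t + a * q t"
      using nz[of t] B_def[of t] unfolding m_def q_def
      by (simp add: divide_simps) (simp add: algebra_simps power2_eq_square)
    ultimately show ?thesis by simp
  qed
  have q': "(q has_real_derivative n t - a * p t) (at t)" for t
  proof -
    have "(q has_real_derivative (cosh t * (1 + B t) - sinh t * (b * sinh t)) / ((1 + B t) * (1 + B t))) (at t)"
      unfolding q_def[abs_def] using nz[of t]
      by (auto intro!: derivative_eq_intros B')
    moreover have "(cosh t * (1 + B t) - sinh t * (b * sinh t)) / ((1 + B t) * (1 + B t)) = n t - a * p t"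
      using nz[of t] B_def[of t] CS[of t] ab unfolding n_def p_def by (simp add: divide_simps) algebra
    ultimately show ?thesis by simp
  qed
  have m': "(m has_real_derivative m' t) (at t)" for t
    unfolding m_def[abs_def] m'_def using nz[of t]
    by (auto intro!: derivative_eq_intros B' simp: divide_simps) algebra
  have n': "(n has_real_derivative n' t) (at t)" for t
    unfolding n_def[abs_def] n'_def using nz[of t]
    by (auto intro!: derivative_eq_intros B' simp: divide_simps) algebra
  \<comment> \<open>The coefficients of velocity and position in \<open>christoffel_diag_imaginary\<close>.\<close>
  define k where "k t = 2 * (b * sinh t) / (B t * (1 + B t))" for t
  define l where "l t = (b\<^sup>2 * ((B t)\<^sup>2 + B t + 1) - (b * sinh t)\<^sup>2) / (B t * (1 + B t))" for t
  have acc1: "m' t - a * n t = k t * m t - l t * p t" for t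
    using nz[of t] B_def[of t] CS[of t] ab unfolding m'_def n_def k_def l_def m_def p_def
    by (simp add: divide_simps) algebra
  have acc2: "n' t + a * m t = k t * n t - l t * q t" for t
    using nz[of t] B_def[of t] CS[of t] ab unfolding n'_def n_def k_def l_def m_def q_def
    by (simp add: divide_simps) algebra
  have "geodesic_endpoint quat_ball quat_metric (0, u 0) (T *\<^sub>R (0, v 0)) (0, u T)"
  proof (rule geodesic_endpointI[where c = "\<lambda>t. (0, u t)" and c' = "\<lambda>t. (0, v t)"])
    fix t
    have "defect (0, u t) = 2 / (1 + B t)"
      using nz[of t] by (simp add: defect_def uu field_simps)
    then show "(0, u t) \<in> quat_ball"
      using Bpos[of t] by (simp flip: defect_pos_iff)
    show "((\<lambda>t. (0, u t)) has_vector_derivative (0, v t)) (at t)"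
      using frame'[OF p' q', of t] by (auto intro!: has_vector_derivative_Pair simp: u_def[abs_def] v_def)
    have "(v has_vector_derivative (m' t - a * n t) *\<^sub>R e1 t + (n' t + a * m t) *\<^sub>R e2 t) (at t)"
      using frame'[OF m' n', of t] by (simp add: v_def[abs_def])
    also have "(m' t - a * n t) *\<^sub>R e1 t + (n' t + a * m t) *\<^sub>R e2 t = k t *\<^sub>R v t - l t *\<^sub>R u t"
      unfolding acc1 acc2 by (simp add: u_def v_def algebra_simps)
    finally show "((\<lambda>t. (0, v t)) has_vector_derivative - christoffel_diag (0, u t) (0, v t)) (at t)"
      unfolding christoffel_diag_imaginary[OF Bpos uu uv vv bS] k_def l_def
      by (auto intro!: has_vector_derivative_Pair)
  qed
  moreover have "u 0 = (a / (1 + b)) *\<^sub>R I"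
    by (simp add: u_def p_def q_def e1_def B_def)
  moreover have "v 0 = (b\<^sup>2 / (1 + b)) *\<^sub>R e"
    using b by (simp add: v_def m_def n_def e2_def B_def power2_eq_square divide_simps) (simp add: algebra_simps)
  moreover have "u T = (1 / (1 + b * cosh T)) *\<^sub>R
      ((a * cosh T * cos (a * T) - sinh T * sin (a * T)) *\<^sub>R I
       + (a * cosh T * sin (a * T) + sinh T * cos (a * T)) *\<^sub>R e)"
    by (simp add: u_def p_def q_def e1_def e2_def B_def algebra_simps diff_divide_distrib add_divide_distrib)
  ultimately show ?thesis by simp
qed

section \<open>Non-zero imaginary points\<close>

lemma injectivity_radius_le:
  assumes "geodesic_endpoint quat_ball quat_metric p v q"
    and "geodesic_endpoint quat_ball quat_metric p v' q" and "v \<noteq> v'"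
  shows "injectivity_radius quat_ball quat_metric p
    \<le> ennreal (max (sqrt (quat_metric p v v)) (sqrt (quat_metric p v' v')))"
  unfolding injectivity_radius_def
proof (rule Sup_least, clarify)
  fix a assume "diffeo_onto_image (exp_map quat_ball quat_metric p) (tangent_ball quat_metric p a)"
  then have inj: "inj_on (exp_map quat_ball quat_metric p) (tangent_ball quat_metric p a)"
    by (simp add: diffeo_onto_image_def)
  have "exp_map quat_ball quat_metric p v = exp_map quat_ball quat_metric p v'"
    using assms by (simp add: quat_exp_map_eq)
  then have "v \<notin> tangent_ball quat_metric p a \<or> v' \<notin> tangent_ball quat_metric p a"
    using inj \<open>v \<noteq> v'\<close> by (auto dest: inj_onD)
  then show "ennreal a \<le> ennreal (max (sqrt (quat_metric p v v)) (sqrt (quat_metric p v' v')))"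
    by (intro ennreal_leI) (auto simp: tangent_ball_def)
qed

text \<open>
  The component of the winding geodesic along \<open>e\<close> is positive when the frame has made a quarter turn
  (at $\pi/(2a)$) and negative after half a turn (at $\pi/a$).
\<close>

lemma half_turn_time:
  assumes "a > 0"
  obtains T where "T > 0" "a * cosh T * sin (a * T) + sinh T * cos (a * T) = (0::real)"
proof -
  let ?f = "\<lambda>t. a * cosh t * sin (a * t) + sinh t * cos (a * t)"
  have "\<exists>t. pi / (2 * a) \<le> t \<and> t \<le> pi / a \<and> ?f t = 0"
    using assms by (intro IVT2') (auto intro!: continuous_intros simp: field_simps)
  then obtain t where "pi / (2 * a) \<le> t" "?f t = 0" by blast
  moreover have "0 < pi / (2 * a)" using assms by simp
  ultimately show thesis by (intro that[of t]) auto
qed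

text \<open>
  The point \<open>r *\<^sub>R I\<close> has conformal coordinate \<open>a = 2r/(1-r\<^sup>2)\<close>.  Replacing \<open>e\<close> by \<open>-e\<close> mirrors the
  winding geodesic; both end at \<open>q\<close> when the component along \<open>e\<close> vanishes.
\<close>

lemma injectivity_radius_imaginary_finite:
  assumes I: "norm I = 1" and r: "0 < r" "r < 1"
  shows "injectivity_radius quat_ball quat_metric (0, r *\<^sub>R I) < \<infinity>"
proof -
  obtain e0 :: "real ^ 3" where "e0 \<noteq> 0" "orthogonal I e0"
    using orthogonal_to_vector_exists[of I] by auto
  define e where "e = e0 /\<^sub>R norm e0"
  have orth: "I \<bullet> I = 1" "e \<bullet> e = 1" "I \<bullet> e = 0" "(- e) \<bullet> (- e) = 1" "I \<bullet> (- e) = 0" "e \<noteq> 0"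
    using I \<open>e0 \<noteq> 0\<close> \<open>orthogonal I e0\<close>
    by (auto simp: e_def orthogonal_def dot_square_norm power2_eq_square)
  define a b where "a = 2 * r / (1 - r\<^sup>2)" and "b = (1 + r\<^sup>2) / (1 - r\<^sup>2)"
  have r2: "r\<^sup>2 < 1" using r by (simp add: abs_square_less_1)
  have a: "a > 0" and b: "b > 0"
    using r r2 by (auto simp: a_def b_def intro!: divide_pos_pos add_pos_nonneg)
  have ab: "b\<^sup>2 = 1 + a\<^sup>2"
    using r2 by (simp add: a_def b_def power_divide divide_simps) algebra
  have start: "a / (1 + b) = r"
    using r2 by (simp add: a_def b_def divide_simps)
  obtain T where T: "T > 0" and half: "a * cosh T * sin (a * T) + sinh T * cos (a * T) = 0"
    using half_turn_time[OF a] .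
  define q where "q = (0::real, (1 / (1 + b * cosh T)) *\<^sub>R
      ((a * cosh T * cos (a * T) - sinh T * sin (a * T)) *\<^sub>R I))"
  have "geodesic_endpoint quat_ball quat_metric (0, r *\<^sub>R I)
      (T *\<^sub>R (0, (b\<^sup>2 / (1 + b)) *\<^sub>R e)) q"
    using winding_geodesic[OF orth(1-3) b ab, of T] by (simp add: start half q_def)
  moreover have "geodesic_endpoint quat_ball quat_metric (0, r *\<^sub>R I)
      (T *\<^sub>R (0, (b\<^sup>2 / (1 + b)) *\<^sub>R (- e))) q"
    using winding_geodesic[OF orth(1,4,5) b ab, of T] by (simp add: start half q_def)
  moreover have "T *\<^sub>R (0::real, (b\<^sup>2 / (1 + b)) *\<^sub>R e) \<noteq> T *\<^sub>R (0, (b\<^sup>2 / (1 + b)) *\<^sub>R (- e))"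
  proof
    assume "T *\<^sub>R (0::real, (b\<^sup>2 / (1 + b)) *\<^sub>R e) = T *\<^sub>R (0, (b\<^sup>2 / (1 + b)) *\<^sub>R (- e))"
    then have "(T * (b\<^sup>2 / (1 + b)) * 2) *\<^sub>R e = 0"
      by (simp add: scaleR_2[symmetric] eq_neg_iff_add_eq_0 mult.commute mult.assoc flip: scaleR_left.add)
    then show False using T b orth(6) by simp
  qed
  ultimately have "injectivity_radius quat_ball quat_metric (0, r *\<^sub>R I) \<le> ennreal (max
      (sqrt (quat_metric (0, r *\<^sub>R I) (T *\<^sub>R (0, (b\<^sup>2 / (1 + b)) *\<^sub>R e)) (T *\<^sub>R (0, (b\<^sup>2 / (1 + b)) *\<^sub>R e))))
      (sqrt (quat_metric (0, r *\<^sub>R I) (T *\<^sub>R (0, (b\<^sup>2 / (1 + b)) *\<^sub>R (- e))) (T *\<^sub>R (0, (b\<^sup>2 / (1 + b)) *\<^sub>R (- e))))))"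
    by (rule injectivity_radius_le)
  then show ?thesis
    by (rule order_le_less_trans) (simp add: ennreal_less_top)
qed

section \<open>The origin\<close>

text \<open>
  The termwise derivative of a power series is a power series that converges on the same interval.
\<close>

lemma smooth_on_powser:
  fixes c :: "nat \<Rightarrow> real"
  assumes "\<And>s. 0 < s \<Longrightarrow> s < R \<Longrightarrow> summable (\<lambda>n. c n * s ^ n)"
  shows "smooth_on (\<lambda>s. \<Sum>n. c n * s ^ n) {-R<..<R}"
proof -
  have conv: "summable (\<lambda>n. c n * s ^ n)" if s: "norm s < R" for s
  proof -
    obtain K where K: "norm s < K" "K < R" using dense[OF s] by blast
    then have "0 < K" using norm_ge_zero[of s] by linarith
    then show ?thesis using K by (intro powser_inside[OF assms[of K]]) simp_all
  qed
  have "Ck_on k (\<lambda>s. \<Sum>n. c n * s ^ n) {-R<..<R}"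
    if "\<And>s. norm s < R \<Longrightarrow> summable (\<lambda>n. c n * s ^ n)" for k c
    using that
  proof (induction k arbitrary: c)
    case (0 c)
    have "isCont (\<lambda>s. \<Sum>n. c n * s ^ n) s" if s: "s \<in> {-R<..<R}" for s
    proof -
      obtain K where K: "norm s < K" "K < R" using s dense[of "norm s" R] by (auto simp: abs_less_iff)
      then have "summable (\<lambda>n. c n * K ^ n)" using 0 by auto
      then show ?thesis using K by (intro DERIV_isCont[OF termdiffs_strong]) auto
    qed
    then show ?case by (auto intro: continuous_at_imp_continuous_on)
  next
    case (Suc k c)
    have diffs: "summable (\<lambda>n. diffs c n * s ^ n)" if "norm s < R" for s
      using termdiff_converges[OF that] Suc.prems by blast
    show ?case
    proof (rule Ck_on_SucI)
      fix s assume s: "s \<in> {-R<..<R}"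
      obtain K where K: "norm s < K" "K < R" using s dense[of "norm s" R] by (auto simp: abs_less_iff)
      then have "summable (\<lambda>n. c n * K ^ n)" using Suc.prems by auto
      then have "((\<lambda>s. \<Sum>n. c n * s ^ n) has_real_derivative (\<Sum>n. diffs c n * s ^ n)) (at s)"
        using K by (intro termdiffs_strong) auto
      then show "((\<lambda>s. \<Sum>n. c n * s ^ n) has_derivative (\<lambda>v. (\<Sum>n. diffs c n * s ^ n) * v)) (at s)"
        by (simp add: has_field_derivative_def)
    next
      fix v :: real
      show "Ck_on k (\<lambda>s. (\<Sum>n. diffs c n * s ^ n) * v) {-R<..<R}"
        using Suc.IH[OF diffs] by (intro Ck_on_bilinear[OF bounded_bilinear_mult] Ck_on_const) auto
    qed auto
  qed
  then show ?thesis using conv by (simp add: smooth_on_def)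
qed

text \<open>
  The entire functions $\sinh(\sqrt s)/\sqrt s$ and $\cosh\sqrt s$, and $\mathrm{artanh}(\sqrt s)/\sqrt s$
  for $|s| < 1$.  They are defined by power series because smoothness at $s = 0$ is the point at
  issue.
\<close>

definition sinhc_sqrt :: "real \<Rightarrow> real" where
  "sinhc_sqrt s = (\<Sum>n. inverse (fact (2 * n + 1)) * s ^ n)"

definition cosh_sqrt :: "real \<Rightarrow> real" where
  "cosh_sqrt s = (\<Sum>n. inverse (fact (2 * n)) * s ^ n)"

definition artanhc_sqrt :: "real \<Rightarrow> real" where
  "artanhc_sqrt s = (\<Sum>n. inverse (real (2 * n + 1)) * s ^ n)"

lemma odd_powser:
  fixes c :: "nat \<Rightarrow> real"
  assumes "(\<lambda>n. c n * x ^ (2 * n + 1)) sums y" "x \<noteq> 0"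
  shows "(\<lambda>n. c n * (x\<^sup>2) ^ n) sums (y / x)"
  using sums_divide[OF assms(1), of x] assms(2) by (simp add: power_mult)

lemma sinhc_sqrt_sums:
  fixes x :: real
  assumes "x \<noteq> 0"
  shows "(\<lambda>n. inverse (fact (2 * n + 1)) * (x\<^sup>2) ^ n) sums (sinh x / x)"
proof (rule odd_powser[OF _ assms])
  have "(\<lambda>n. if even (2 * n + 1) then 0 else x ^ (2 * n + 1) /\<^sub>R fact (2 * n + 1)) sums sinh x"
    using sinh_converges[of x]
    by (subst sums_mono_reindex[where g = "\<lambda>n. 2 * n + 1" and f = "\<lambda>n. if even n then 0 else x ^ n /\<^sub>R fact n"])
      (auto simp: strict_mono_def elim!: oddE)
  then show "(\<lambda>n. inverse (fact (2 * n + 1)) * x ^ (2 * n + 1)) sums sinh x"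
    by simp
qed

lemma cosh_sqrt_sums:
  fixes x :: real
  shows "(\<lambda>n. inverse (fact (2 * n)) * (x\<^sup>2) ^ n) sums cosh x"
proof -
  have "(\<lambda>n. if even (2 * n) then x ^ (2 * n) /\<^sub>R fact (2 * n) else 0) sums cosh x"
    using cosh_converges[of x]
    by (subst sums_mono_reindex[where g = "\<lambda>n. 2 * n" and f = "\<lambda>n. if even n then x ^ n /\<^sub>R fact n else 0"])
      (auto simp: strict_mono_def elim!: evenE)
  then show ?thesis
    by (simp add: power_mult)
qed

lemma artanhc_sqrt_sums:
  fixes x :: real
  assumes "x \<noteq> 0" "\<bar>x\<bar> < 1"
  shows "(\<lambda>n. inverse (real (2 * n + 1)) * (x\<^sup>2) ^ n) sums (artanh x / x)"
proof (rule odd_powser[OF _ assms(1)])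
  let ?z = "(1 + x) / (1 - x)"
  have "?z > 0" using assms by (auto simp: abs_less_iff)
  moreover have "(?z - 1) / (?z + 1) = x"
    using assms by (simp add: divide_simps)
  ultimately have "(\<lambda>n. 2 * x ^ (2 * n + 1) / of_nat (2 * n + 1)) sums ln ?z"
    using ln_series_quadratic[of ?z] by simp
  then have "(\<lambda>n. 2 * x ^ (2 * n + 1) / of_nat (2 * n + 1) / 2) sums artanh x"
    unfolding artanh_def by (rule sums_divide)
  moreover have "2 * x ^ (2 * n + 1) / of_nat (2 * n + 1) / 2 = inverse (real (2 * n + 1)) * x ^ (2 * n + 1)" for n
    by (simp only: divide_inverse) simp
  ultimately show "(\<lambda>n. inverse (real (2 * n + 1)) * x ^ (2 * n + 1)) sums artanh x"
    by (simp only:)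
qed

lemma smooth_on_sinhc_sqrt: "smooth_on sinhc_sqrt {-R<..<R}"
  unfolding sinhc_sqrt_def[abs_def]
proof (rule smooth_on_powser)
  fix s :: real assume "0 < s"
  then show "summable (\<lambda>n. inverse (fact (2 * n + 1)) * s ^ n)"
    using sums_summable[OF sinhc_sqrt_sums[of "sqrt s"]] by simp
qed

lemma smooth_on_cosh_sqrt: "smooth_on cosh_sqrt {-R<..<R}"
  unfolding cosh_sqrt_def[abs_def]
proof (rule smooth_on_powser)
  fix s :: real assume "0 < s"
  then show "summable (\<lambda>n. inverse (fact (2 * n)) * s ^ n)"
    using sums_summable[OF cosh_sqrt_sums[of "sqrt s"]] by simp
qed

lemma smooth_on_artanhc_sqrt: "smooth_on artanhc_sqrt {-1<..<1}"
  unfolding artanhc_sqrt_def[abs_def]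
proof (rule smooth_on_powser)
  fix s :: real assume "0 < s" "s < 1"
  then show "summable (\<lambda>n. inverse (real (2 * n + 1)) * s ^ n)"
    using sums_summable[OF artanhc_sqrt_sums[of "sqrt s"]] by simp
qed

text \<open>
  The map $v \mapsto \tanh(|v|)\, v/|v|$ and its inverse, in a form whose smoothness at \<open>0\<close> is visible.
\<close>

definition radial_tanh :: "'a::euclidean_space \<Rightarrow> 'a" where
  "radial_tanh v = (sinhc_sqrt (v \<bullet> v) / cosh_sqrt (v \<bullet> v)) *\<^sub>R v"

definition radial_artanh :: "'a::euclidean_space \<Rightarrow> 'a" where
  "radial_artanh w = artanhc_sqrt (w \<bullet> w) *\<^sub>R w"

lemma cosh_sqrt_square: "cosh_sqrt (x\<^sup>2) = cosh x"
  unfolding cosh_sqrt_def using sums_unique[OF cosh_sqrt_sums] by simp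

lemma radial_tanh_unit:
  assumes "norm V = 1" shows "radial_tanh (t *\<^sub>R V) = tanh t *\<^sub>R V"
proof (cases "t = 0")
  case False
  have "(t *\<^sub>R V) \<bullet> (t *\<^sub>R V) = t\<^sup>2"
    using assms by (simp add: dot_square_norm power_mult_distrib del: inner_scaleR_left inner_scaleR_right)
  moreover have "sinhc_sqrt (t\<^sup>2) = sinh t / t"
    unfolding sinhc_sqrt_def using sums_unique[OF sinhc_sqrt_sums[OF False]] by simp
  ultimately show ?thesis
    using False unfolding radial_tanh_def by (simp only: cosh_sqrt_square tanh_def) simp
qed (simp add: radial_tanh_def)

lemma radial_artanh_unit:
  assumes "norm V = 1" "\<bar>t\<bar> < 1" shows "radial_artanh (t *\<^sub>R V) = artanh t *\<^sub>R V"
proof (cases "t = 0")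
  case False
  have "(t *\<^sub>R V) \<bullet> (t *\<^sub>R V) = t\<^sup>2"
    using assms by (simp add: dot_square_norm power_mult_distrib del: inner_scaleR_left inner_scaleR_right)
  moreover have "artanhc_sqrt (t\<^sup>2) = artanh t / t"
    unfolding artanhc_sqrt_def using sums_unique[OF artanhc_sqrt_sums[OF False assms(2)]] by simp
  ultimately show ?thesis
    using False unfolding radial_artanh_def by simp
qed (simp add: radial_artanh_def)

lemma polar_decomposition:
  fixes v :: "'a::euclidean_space"
  obtains t V where "norm V = 1" "0 \<le> t" "v = t *\<^sub>R V"
proof (cases "v = 0")
  case True
  obtain V :: 'a where "V \<in> Basis" using nonempty_Basis by blast
  then show thesis using True by (intro that[of V 0]) auto
next
  case False
  then show thesis by (intro that[of "v /\<^sub>R norm v" "norm v"]) auto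
qed

lemma tanh_artanh_real:
  fixes x :: real
  assumes "\<bar>x\<bar> < 1" shows "tanh (artanh x) = x"
proof -
  have "(1 + x) / (1 - x) > 0" using assms by (auto simp: abs_less_iff)
  then have "exp (- 2 * artanh x) = (1 - x) / (1 + x)"
    by (simp add: artanh_def exp_minus)
  moreover have "1 + x \<noteq> 0" using assms by auto
  ultimately show ?thesis
    by (simp only: tanh_real_altdef) (simp add: divide_simps)
qed

lemma radial_artanh_tanh: "radial_artanh (radial_tanh v) = v"
proof -
  obtain t V where V: "norm V = 1" "v = t *\<^sub>R V" by (rule polar_decomposition)
  have "\<bar>tanh t\<bar> < 1"
    using tanh_real_bounds[of t] by (simp add: abs_less_iff)
  then show ?thesis
    by (simp add: V(2) radial_tanh_unit[OF V(1)] radial_artanh_unit[OF V(1)] artanh_tanh_real)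
qed

lemma radial_tanh_image_ball: "radial_tanh ` ball 0 a = ball 0 (tanh a)"
proof (intro equalityI subsetI)
  fix w assume "w \<in> radial_tanh ` ball 0 a"
  then obtain v where v: "norm v < a" "w = radial_tanh v" by auto
  obtain t V where V: "norm V = 1" "0 \<le> t" "v = t *\<^sub>R V" by (rule polar_decomposition)
  have "norm w = tanh t" "t < a"
    using v V by (simp_all add: radial_tanh_unit)
  then show "w \<in> ball 0 (tanh a)" by simp
next
  fix w :: 'a assume "w \<in> ball 0 (tanh a)"
  then have w: "norm w < tanh a" by simp
  obtain \<rho> V where V: "norm V = 1" "0 \<le> \<rho>" "w = \<rho> *\<^sub>R V" by (rule polar_decomposition)
  have \<rho>: "\<rho> < tanh a" using w V by simp
  then have t: "tanh (artanh \<rho>) = \<rho>"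
    using V(2) tanh_real_bounds[of a] by (intro tanh_artanh_real) auto
  then have "artanh \<rho> < a"
    using \<rho> by (metis tanh_real_less_iff)
  moreover have "0 \<le> artanh \<rho>"
    using t V(2) by (metis tanh_real_nonneg_iff)
  ultimately have "artanh \<rho> *\<^sub>R V \<in> ball 0 a" using V(1) by simp
  moreover have "w = radial_tanh (artanh \<rho> *\<^sub>R V)"
    using V t by (simp add: radial_tanh_unit)
  ultimately show "w \<in> radial_tanh ` ball 0 a" by blast
qed

lemma smooth_on_dot_self: "open S \<Longrightarrow> smooth_on (\<lambda>v. v \<bullet> v) S"
  by (intro smooth_on_inner smooth_on_linear bounded_linear_ident)

text \<open>
  On the ball of radius \<open>a\<close> the argument \<open>v \<bullet> v\<close> stays below \<open>a\<^sup>2\<close>, and \<open>cosh_sqrt\<close> has no zeros at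
  nonnegative arguments.
\<close>

lemma diffeo_radial_tanh: "diffeo_onto_image (radial_tanh :: 'a::euclidean_space \<Rightarrow> 'a) (ball 0 a)"
proof -
  let ?S = "ball 0 a :: 'a set"
  have dot: "v \<bullet> v \<in> {-a\<^sup>2<..<a\<^sup>2}" if "v \<in> ball 0 a" for v :: 'a
  proof -
    have "v \<bullet> v < a\<^sup>2"
      using that by (auto simp: dot_square_norm intro!: power_strict_mono)
    moreover from this have "- a\<^sup>2 < v \<bullet> v" using inner_ge_zero[of v] by linarith
    ultimately show ?thesis by simp
  qed
  have comp: "smooth_on (\<lambda>v::'a. h (v \<bullet> v)) ?S" if "smooth_on h {-a\<^sup>2<..<a\<^sup>2}"
    for h :: "real \<Rightarrow> real"
    by (rule smooth_on_compose_real[OF open_ball _ smooth_on_dot_self[OF open_ball] that]) (use dot in auto)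
  have 1: "smooth_on radial_tanh ?S"
    unfolding radial_tanh_def[abs_def]
    by (intro smooth_on_scaleR smooth_on_divide comp[OF smooth_on_sinhc_sqrt]
        comp[OF smooth_on_cosh_sqrt] smooth_on_linear bounded_linear_ident)
      (simp_all add: dot_square_norm cosh_sqrt_square)
  have dot1: "w \<bullet> w \<in> {-1<..<1}" if "w \<in> ball 0 (tanh a)" for w :: 'a
  proof -
    have "norm w < 1" using that tanh_real_bounds[of a] by auto
    then have "w \<bullet> w < 1" by (simp add: dot_square_norm abs_square_less_1)
    moreover have "- 1 < w \<bullet> w" using inner_ge_zero[of w] by linarith
    ultimately show ?thesis by simp
  qed
  have "smooth_on (\<lambda>w. artanhc_sqrt (w \<bullet> w)) (ball 0 (tanh a) :: 'a set)"
    by (rule smooth_on_compose_real[OF open_ball _ smooth_on_dot_self[OF open_ball] smooth_on_artanhc_sqrt])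
      (use dot1 in auto)
  then have smooth: "smooth_on radial_artanh (ball 0 (tanh a) :: 'a set)"
    unfolding radial_artanh_def[abs_def]
    by (intro smooth_on_scaleR[OF open_ball] smooth_on_linear[OF bounded_linear_ident])
  have inj: "inj_on radial_tanh ?S"
    by (rule inj_on_inverseI) (rule radial_artanh_tanh)
  have inverse: "radial_artanh w = inv_into ?S radial_tanh w" if "w \<in> ball 0 (tanh a)" for w
    using that unfolding radial_tanh_image_ball[symmetric]
    by (metis f_inv_into_f radial_artanh_tanh)
  have "smooth_on (inv_into ?S radial_tanh) (radial_tanh ` ?S)"
    unfolding radial_tanh_image_ball by (rule smooth_on_cong[OF open_ball smooth inverse])
  then show ?thesis
    using 1 inj by (simp add: diffeo_onto_image_def radial_tanh_image_ball)
qed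

text \<open>
  The metric at \<open>0\<close> is the Euclidean inner product, so the tangent balls are the Euclidean balls, and
  every radius is admissible.
\<close>

lemma injectivity_radius_origin: "injectivity_radius quat_ball quat_metric 0 = \<infinity>"
proof -
  have "exp_map quat_ball quat_metric 0 v = radial_tanh v \<and> v \<in> exp_domain quat_ball quat_metric 0" for v
  proof -
    obtain t V where V: "norm V = 1" "v = t *\<^sub>R V" by (rule polar_decomposition)
    have "geodesic_endpoint quat_ball quat_metric 0 v (radial_tanh v)"
      unfolding V(2) radial_tanh_unit[OF V(1)] by (rule radial_geodesic[OF V(1)])
    then show ?thesis by (simp add: quat_exp_map_eq)
  qed
  then have exp: "exp_map quat_ball quat_metric 0 = radial_tanh"
    and dom: "exp_domain quat_ball quat_metric 0 = UNIV" by auto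
  have "(0::quat) \<in> quat_ball" by (simp add: quat_ball_def)
  then have "quat_metric 0 v v = (norm v)\<^sup>2" for v
    by (cases v) (simp add: quat_metric_formula defect_def square_defect_def norm_Pair
        dot_square_norm flip: power2_eq_square)
  then have ball: "tangent_ball quat_metric 0 a = ball 0 a" for a
    by (auto simp: tangent_ball_def)
  have "ennreal (real n) \<le> injectivity_radius quat_ball quat_metric 0" if "n > 0" for n
    unfolding injectivity_radius_def using that
    by (intro Sup_upper) (auto simp: exp dom ball diffeo_radial_tanh intro!: exI[of _ "real n"])
  then have "of_nat n \<le> injectivity_radius quat_ball quat_metric 0" for n
    by (cases "n = 0") (auto simp: ennreal_of_nat_eq_real_of_nat)
  then show ?thesis
    using ennreal_Ex_less_of_nat[of "injectivity_radius quat_ball quat_metric 0"]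
    by (metis less_top infinity_ennreal_def leD)
qed

theorem lemma4p10:
  fixes J :: quat
  assumes "J \<in> imag_units"
  shows "(\<forall>q \<in> disc_half_pi (great_circle J).
            q \<noteq> 0 \<longrightarrow> injectivity_radius quat_ball quat_metric q < \<infinity>) \<and>
         injectivity_radius quat_ball quat_metric 0 = \<infinity>"
proof (intro conjI ballI impI)
  fix q assume "q \<in> disc_half_pi (great_circle J)" "q \<noteq> 0"
  then obtain r I where q: "q = (0, r *\<^sub>R I)" and I: "norm I = 1" and r: "0 \<le> r" "r < 1"
    unfolding disc_half_pi_def great_circle_def imag_units_eq by auto
  then have "r \<noteq> 0" using \<open>q \<noteq> 0\<close> by (auto simp: zero_prod_def)
  then show "injectivity_radius quat_ball quat_metric q < \<infinity>"
    using injectivity_radius_imaginary_finite[OF I] q r by simp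
qed (rule injectivity_radius_origin)

end
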